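(* Let $(M_1,J,g_1)$ be an almost Hermitian manifold with fundamental 2-form $\Phi_1$, carrying a 1-form $\omega$ with $d\omega=\Phi_1$, and let $(M_2,\phi,\xi,\eta,g_2)$ be a K-contact manifold. Let $\alpha\in\mathbb{R}$, let $f\in C^\infty(M_1,\mathbb{R})$ be positive, and equip $M=M_1\times M_2$ with $\bar\eta(X_1,X_2)=\alpha\,\omega(X_1)+\eta(X_2)$ and the metric $$g\bigl((X_1,X_2),(Y_1,Y_2)\bigr)=g_1(X_1,Y_1)+f^2\bigl(g_2(X_2,Y_2)-\eta(X_2)\eta(Y_2)\bigr)+\bar\eta(X_1,X_2)\,\bar\eta(Y_1,Y_2).$$ Let $\tilde\nabla$ and $\nabla$ be the Levi-Civita connections on $M_2$ and $M$ respectively. Then for all $U,V\in\chi(M_2)$, $$\nabla_{(0,U)}(0,V)=\Bigl(-f\,g_2(\phi U,\phi V)\,\operatorname{grad}f,\ \ \tilde\nabla_UV+\frac{f^2-1}{f^2}\bigl(\eta(V)\phi(U)+\eta(U)\phi(V)\bigr)+\alpha f\,g_2(\phi U,\phi V)\,\omega(\operatorname{grad}f)\,\xi\Bigr).$$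
   Context: An almost Hermitian manifold $(M_1,J,g_1)$ has $J^2=-\mathrm{id}$ and $g_1(JX,JY)=g_1(X,Y)$; its fundamental 2-form is $\Phi_1(X,Y)=g_1(X,JY)$. The exterior derivative of a 1-form is normalized by $2\,d\eta(X,Y)=X\eta(Y)-Y\eta(X)-\eta([X,Y])$. Vector fields on the product are written $(X_1,X_2)$ with $X_1$ tangent to $M_1$ and $X_2$ tangent to $M_2$; $\operatorname{grad}f$ is the gradient of $f$ on $(M_1,g_1)$, i.e. $g_1(\operatorname{grad}f,Y)=Y[f]$. A contact metric manifold $(M_2,\phi,\xi,\eta,g_2)$ is an odd-dimensional manifold with a $(1,1)$-tensor field $\phi$, a vector field $\xi$, a 1-form $\eta$ and a Riemannian metric $g_2$ satisfying $\phi^2U=-U+\eta(U)\xi$, $\eta(\xi)=1$, $g_2(\phi U,\phi V)=g_2(U,V)-\eta(U)\eta(V)$ and $d\eta(U,V)=g_2(U,\phi V)$ for all $U,V\in\chi(M_2)$. A K-contact manifold is a contact metric manifold for which $\xi$ is a Killing vector field. *)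

theory Defs
  imports "HOL-Analysis.Analysis" "HOL-Library.Function_Algebras"
begin

section \<open>Functions into a real vector space\<close>

text \<open>
  Tangent vectors are functionals on functions and vector fields are functions into tangent
  vectors; both become real vector spaces pointwise.
\<close>

instantiation "fun" :: (type, scaleR) scaleR
begin

definition scaleR_fun :: "real \<Rightarrow> ('a \<Rightarrow> 'b) \<Rightarrow> 'a \<Rightarrow> 'b"
  where "scaleR_fun c f = (\<lambda>x. c *\<^sub>R f x)"

instance ..

end

lemma scaleR_fun_apply [simp]: "(c *\<^sub>R f) x = c *\<^sub>R f x"
  by (simp add: scaleR_fun_def)

instance "fun" :: (type, real_vector) real_vector
  by standard (simp_all add: fun_eq_iff scaleR_add_right scaleR_add_left)


section \<open>Smooth manifolds\<close>

text \<open>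
  \<^term>\<open>Ck_on k f S\<close> is used for open sets \<^term>\<open>S\<close> only.
\<close>

primrec Ck_on :: "nat \<Rightarrow> ('d::euclidean_space \<Rightarrow> 'e::euclidean_space) \<Rightarrow> 'd set \<Rightarrow> bool" where
  "Ck_on 0 f S = continuous_on S f"
| "Ck_on (Suc k) f S =
    ((\<forall>x\<in>S. f differentiable (at x)) \<and> (\<forall>v. Ck_on k (\<lambda>x. frechet_derivative f (at x) v) S))"

definition smooth_on :: "'d::euclidean_space set \<Rightarrow> ('d \<Rightarrow> 'e::euclidean_space) \<Rightarrow> bool"
  where "smooth_on S f \<longleftrightarrow> (\<forall>k. Ck_on k f S)"

text \<open>
  The underlying set of a manifold is a whole type \<^typ>\<open>'a\<close> (second countable and Hausdorff by its
  type class, see \<open>manifold\<close> below), and charts take values in the Euclidean space \<^typ>\<open>'d\<close>, so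
  that the dimension is \<open>DIM('d)\<close>.  A chart is a pair of its domain and its coordinate map.
\<close>

type_synonym ('a, 'd) atlas = "('a set \<times> ('a \<Rightarrow> 'd)) set"

definition manifold ::
    "('a::{t2_space, second_countable_topology}, 'd::euclidean_space) atlas \<Rightarrow> bool"
  where "manifold A \<longleftrightarrow>
    (\<Union>(D, c)\<in>A. D) = UNIV \<and>
    (\<forall>(D, c)\<in>A. open D \<and> open (c ` D) \<and> homeomorphism D (c ` D) c (inv_into D c)) \<and>
    (\<forall>(D, c)\<in>A. \<forall>(E, e)\<in>A. smooth_on (c ` (D \<inter> E)) (e \<circ> inv_into D c))"

definition smooth_fun :: "('a, 'd::euclidean_space) atlas \<Rightarrow> ('a \<Rightarrow> real) \<Rightarrow> bool"
  where "smooth_fun A h \<longleftrightarrow> (\<forall>(D, c)\<in>A. smooth_on (c ` D) (h \<circ> inv_into D c))"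

definition prod_atlas ::
    "('a, 'd) atlas \<Rightarrow> ('b, 'e) atlas \<Rightarrow> ('a \<times> 'b, 'd \<times> 'e) atlas"
  where "prod_atlas A B = {(D \<times> E, map_prod c e) | D c E e. (D, c) \<in> A \<and> (E, e) \<in> B}"


section \<open>Tangent vectors, vector fields and tensor fields\<close>

text \<open>
  The tangent space at \<^term>\<open>p\<close> consists of the derivations at \<^term>\<open>p\<close> of the algebra of smooth
  functions.  A derivation is given the value 0 on non-smooth functions, so that two tangent
  vectors are equal as soon as they agree on smooth functions.
\<close>

type_synonym 'a tangent = "('a \<Rightarrow> real) \<Rightarrow> real"

definition tangent_space :: "('a, 'd::euclidean_space) atlas \<Rightarrow> 'a \<Rightarrow> 'a tangent set"
  where "tangent_space A p =
    {v. (\<forall>h k. smooth_fun A h \<longrightarrow> smooth_fun A k \<longrightarrow>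
           v (\<lambda>x. h x + k x) = v h + v k \<and>
           v (\<lambda>x. h x * k x) = h p * v k + k p * v h) \<and>
        (\<forall>c h. smooth_fun A h \<longrightarrow> v (\<lambda>x. c * h x) = c * v h) \<and>
        (\<forall>h. \<not> smooth_fun A h \<longrightarrow> v h = 0)}"

type_synonym 'a vfield = "'a \<Rightarrow> 'a tangent"

definition vfields :: "('a, 'd::euclidean_space) atlas \<Rightarrow> 'a vfield set"
  where "vfields A = {X. (\<forall>p. X p \<in> tangent_space A p) \<and>
    (\<forall>h. smooth_fun A h \<longrightarrow> smooth_fun A (\<lambda>p. X p h))}"

text \<open>The derivative \<open>X[h]\<close> of a function along a vector field, and the Lie bracket.\<close>

definition vderiv :: "'a vfield \<Rightarrow> ('a \<Rightarrow> real) \<Rightarrow> 'a \<Rightarrow> real"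
  where "vderiv X h = (\<lambda>p. X p h)"

definition bracket :: "'a vfield \<Rightarrow> 'a vfield \<Rightarrow> 'a vfield"
  where "bracket X Y = (\<lambda>p h. X p (vderiv Y h) - Y p (vderiv X h))"

text \<open>
  Tensor fields are given pointwise; only their values on tangent vectors matter.
\<close>

definition one_form :: "('a, 'd::euclidean_space) atlas \<Rightarrow> ('a \<Rightarrow> 'a tangent \<Rightarrow> real) \<Rightarrow> bool"
  where "one_form A \<omega> \<longleftrightarrow>
    (\<forall>p. \<forall>v\<in>tangent_space A p. \<forall>w\<in>tangent_space A p. \<forall>a b.
        \<omega> p (a *\<^sub>R v + b *\<^sub>R w) = a * \<omega> p v + b * \<omega> p w) \<and>
    (\<forall>X\<in>vfields A. smooth_fun A (\<lambda>p. \<omega> p (X p)))"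

definition tensor11 ::
    "('a, 'd::euclidean_space) atlas \<Rightarrow> ('a \<Rightarrow> 'a tangent \<Rightarrow> 'a tangent) \<Rightarrow> bool"
  where "tensor11 A F \<longleftrightarrow>
    (\<forall>p. \<forall>v\<in>tangent_space A p. F p v \<in> tangent_space A p) \<and>
    (\<forall>p. \<forall>v\<in>tangent_space A p. \<forall>w\<in>tangent_space A p. \<forall>a b.
        F p (a *\<^sub>R v + b *\<^sub>R w) = a *\<^sub>R F p v + b *\<^sub>R F p w) \<and>
    (\<forall>X\<in>vfields A. (\<lambda>p. F p (X p)) \<in> vfields A)"

definition riemannian_metric ::
    "('a, 'd::euclidean_space) atlas \<Rightarrow> ('a \<Rightarrow> 'a tangent \<Rightarrow> 'a tangent \<Rightarrow> real) \<Rightarrow> bool"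
  where "riemannian_metric A g \<longleftrightarrow>
    (\<forall>p. \<forall>u\<in>tangent_space A p. \<forall>v\<in>tangent_space A p. \<forall>w\<in>tangent_space A p. \<forall>a b.
        g p (a *\<^sub>R u + b *\<^sub>R v) w = a * g p u w + b * g p v w) \<and>
    (\<forall>p. \<forall>v\<in>tangent_space A p. \<forall>w\<in>tangent_space A p. g p v w = g p w v) \<and>
    (\<forall>p. \<forall>v\<in>tangent_space A p. v \<noteq> 0 \<longrightarrow> g p v v > 0) \<and>
    (\<forall>X\<in>vfields A. \<forall>Y\<in>vfields A. smooth_fun A (\<lambda>p. g p (X p) (Y p)))"

text \<open>The normalization is \<open>2 d\<omega>(X, Y) = X \<omega>(Y) - Y \<omega>(X) - \<omega>([X, Y])\<close>.\<close>

definition ext_deriv ::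
    "('a \<Rightarrow> 'a tangent \<Rightarrow> real) \<Rightarrow> 'a vfield \<Rightarrow> 'a vfield \<Rightarrow> 'a \<Rightarrow> real"
  where "ext_deriv \<omega> X Y = (\<lambda>p.
    (X p (\<lambda>q. \<omega> q (Y q)) - Y p (\<lambda>q. \<omega> q (X q)) - \<omega> p (bracket X Y p)) / 2)"

definition gradient ::
    "('a, 'd::euclidean_space) atlas \<Rightarrow> ('a \<Rightarrow> 'a tangent \<Rightarrow> 'a tangent \<Rightarrow> real)
      \<Rightarrow> ('a \<Rightarrow> real) \<Rightarrow> 'a vfield"
  where "gradient A g f = (\<lambda>p.
    THE v. v \<in> tangent_space A p \<and> (\<forall>w\<in>tangent_space A p. g p v w = w f))"

definition levi_civita ::
    "('a, 'd::euclidean_space) atlas \<Rightarrow> ('a \<Rightarrow> 'a tangent \<Rightarrow> 'a tangent \<Rightarrow> real)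
      \<Rightarrow> ('a vfield \<Rightarrow> 'a vfield \<Rightarrow> 'a vfield) \<Rightarrow> bool"
  where "levi_civita A g nabla \<longleftrightarrow>
    (\<forall>X\<in>vfields A. \<forall>Y\<in>vfields A. nabla X Y \<in> vfields A) \<and>
    (\<forall>X\<in>vfields A. \<forall>Y\<in>vfields A. \<forall>Z\<in>vfields A.
        nabla (X + Y) Z = nabla X Z + nabla Y Z \<and>
        nabla X (Y + Z) = nabla X Y + nabla X Z) \<and>
    (\<forall>X\<in>vfields A. \<forall>Y\<in>vfields A. \<forall>h. smooth_fun A h \<longrightarrow>
        nabla (\<lambda>p. h p *\<^sub>R X p) Y = (\<lambda>p. h p *\<^sub>R nabla X Y p) \<and>
        nabla X (\<lambda>p. h p *\<^sub>R Y p) = (\<lambda>p. vderiv X h p *\<^sub>R Y p + h p *\<^sub>R nabla X Y p)) \<and>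
    (\<forall>X\<in>vfields A. \<forall>Y\<in>vfields A. nabla X Y - nabla Y X = bracket X Y) \<and>
    (\<forall>X\<in>vfields A. \<forall>Y\<in>vfields A. \<forall>Z\<in>vfields A.
        vderiv X (\<lambda>p. g p (Y p) (Z p)) =
          (\<lambda>p. g p (nabla X Y p) (Z p) + g p (Y p) (nabla X Z p)))"

text \<open>\<open>\<xi>\<close> is Killing if the Lie derivative of \<open>g\<close> along \<open>\<xi>\<close> vanishes.\<close>

definition killing ::
    "('a, 'd::euclidean_space) atlas \<Rightarrow> ('a \<Rightarrow> 'a tangent \<Rightarrow> 'a tangent \<Rightarrow> real)
      \<Rightarrow> 'a vfield \<Rightarrow> bool"
  where "killing A g \<xi> \<longleftrightarrow> \<xi> \<in> vfields A \<and>
    (\<forall>X\<in>vfields A. \<forall>Y\<in>vfields A. \<forall>p.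
        \<xi> p (\<lambda>q. g q (X q) (Y q)) - g p (bracket \<xi> X p) (Y p) - g p (X p) (bracket \<xi> Y p) = 0)"


section \<open>Almost Hermitian and K-contact manifolds\<close>

definition almost_hermitian ::
    "('a::{t2_space, second_countable_topology}, 'd::euclidean_space) atlas
      \<Rightarrow> ('a \<Rightarrow> 'a tangent \<Rightarrow> 'a tangent) \<Rightarrow> ('a \<Rightarrow> 'a tangent \<Rightarrow> 'a tangent \<Rightarrow> real) \<Rightarrow> bool"
  where "almost_hermitian A J g \<longleftrightarrow>
    manifold A \<and> tensor11 A J \<and> riemannian_metric A g \<and>
    (\<forall>X\<in>vfields A. \<forall>p. J p (J p (X p)) = - X p) \<and>
    (\<forall>X\<in>vfields A. \<forall>Y\<in>vfields A. \<forall>p. g p (J p (X p)) (J p (Y p)) = g p (X p) (Y p))"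

definition fundamental_form ::
    "('a \<Rightarrow> 'a tangent \<Rightarrow> 'a tangent) \<Rightarrow> ('a \<Rightarrow> 'a tangent \<Rightarrow> 'a tangent \<Rightarrow> real)
      \<Rightarrow> 'a vfield \<Rightarrow> 'a vfield \<Rightarrow> 'a \<Rightarrow> real"
  where "fundamental_form J g X Y = (\<lambda>p. g p (X p) (J p (Y p)))"

definition contact_metric ::
    "('a::{t2_space, second_countable_topology}, 'd::euclidean_space) atlas
      \<Rightarrow> ('a \<Rightarrow> 'a tangent \<Rightarrow> 'a tangent) \<Rightarrow> 'a vfield \<Rightarrow> ('a \<Rightarrow> 'a tangent \<Rightarrow> real)
      \<Rightarrow> ('a \<Rightarrow> 'a tangent \<Rightarrow> 'a tangent \<Rightarrow> real) \<Rightarrow> bool"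
  where "contact_metric (A :: ('a, 'd) atlas) \<phi> \<xi> \<eta> g \<longleftrightarrow>
    manifold A \<and> odd DIM('d) \<and>
    tensor11 A \<phi> \<and> \<xi> \<in> vfields A \<and> one_form A \<eta> \<and> riemannian_metric A g \<and>
    (\<forall>U\<in>vfields A. \<forall>p. \<phi> p (\<phi> p (U p)) = - U p + \<eta> p (U p) *\<^sub>R \<xi> p) \<and>
    (\<forall>p. \<eta> p (\<xi> p) = 1) \<and>
    (\<forall>U\<in>vfields A. \<forall>V\<in>vfields A. \<forall>p.
        g p (\<phi> p (U p)) (\<phi> p (V p)) = g p (U p) (V p) - \<eta> p (U p) * \<eta> p (V p)) \<and>
    (\<forall>U\<in>vfields A. \<forall>V\<in>vfields A. \<forall>p. ext_deriv \<eta> U V p = g p (U p) (\<phi> p (V p)))"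

definition K_contact ::
    "('a::{t2_space, second_countable_topology}, 'd::euclidean_space) atlas
      \<Rightarrow> ('a \<Rightarrow> 'a tangent \<Rightarrow> 'a tangent) \<Rightarrow> 'a vfield \<Rightarrow> ('a \<Rightarrow> 'a tangent \<Rightarrow> real)
      \<Rightarrow> ('a \<Rightarrow> 'a tangent \<Rightarrow> 'a tangent \<Rightarrow> real) \<Rightarrow> bool"
  where "K_contact A \<phi> \<xi> \<eta> g \<longleftrightarrow> contact_metric A \<phi> \<xi> \<eta> g \<and> killing A g \<xi>"


section \<open>The product manifold\<close>

text \<open>
  The differential of a smooth map \<^term>\<open>F\<close> into the manifold with atlas \<^term>\<open>B\<close>, applied to a
  tangent vector; \<^term>\<open>B\<close> is only needed to keep the value 0 on non-smooth functions.
\<close>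

definition pushforward ::
    "('b, 'e::euclidean_space) atlas \<Rightarrow> ('a \<Rightarrow> 'b) \<Rightarrow> 'a tangent \<Rightarrow> 'b tangent"
  where "pushforward B F v = (\<lambda>h. if smooth_fun B h then v (h \<circ> F) else 0)"

text \<open>
  \<open>prod_vec A B (p, q) v w\<close> is the tangent vector \<open>(v, w)\<close> at \<open>(p, q)\<close>, under the identification
  of the tangent space of the product at \<open>(p, q)\<close> with the product of the tangent spaces.  The
  components of a tangent vector of the product are its pushforwards under the projections.
\<close>

definition prod_vec ::
    "('a, 'd::euclidean_space) atlas \<Rightarrow> ('b, 'e::euclidean_space) atlas \<Rightarrow> 'a \<times> 'b
      \<Rightarrow> 'a tangent \<Rightarrow> 'b tangent \<Rightarrow> ('a \<times> 'b) tangent"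
  where "prod_vec A B x v w =
    pushforward (prod_atlas A B) (\<lambda>p. (p, snd x)) v +
    pushforward (prod_atlas A B) (\<lambda>q. (fst x, q)) w"

definition vertical ::
    "('a, 'd::euclidean_space) atlas \<Rightarrow> ('b, 'e::euclidean_space) atlas
      \<Rightarrow> 'b vfield \<Rightarrow> ('a \<times> 'b) vfield"
  where "vertical A B U = (\<lambda>(p, q). prod_vec A B (p, q) 0 (U q))"

definition bar_eta ::
    "('a, 'd::euclidean_space) atlas \<Rightarrow> ('b, 'e::euclidean_space) atlas
      \<Rightarrow> real \<Rightarrow> ('a \<Rightarrow> 'a tangent \<Rightarrow> real) \<Rightarrow> ('b \<Rightarrow> 'b tangent \<Rightarrow> real)
      \<Rightarrow> 'a \<times> 'b \<Rightarrow> ('a \<times> 'b) tangent \<Rightarrow> real"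
  where "bar_eta A B \<alpha> \<omega> \<eta> = (\<lambda>(p, q) x.
    \<alpha> * \<omega> p (pushforward A fst x) + \<eta> q (pushforward B snd x))"

definition twisted_warped_metric ::
    "('a, 'd::euclidean_space) atlas \<Rightarrow> ('b, 'e::euclidean_space) atlas
      \<Rightarrow> real \<Rightarrow> ('a \<Rightarrow> real) \<Rightarrow> ('a \<Rightarrow> 'a tangent \<Rightarrow> real) \<Rightarrow> ('b \<Rightarrow> 'b tangent \<Rightarrow> real)
      \<Rightarrow> ('a \<Rightarrow> 'a tangent \<Rightarrow> 'a tangent \<Rightarrow> real) \<Rightarrow> ('b \<Rightarrow> 'b tangent \<Rightarrow> 'b tangent \<Rightarrow> real)
      \<Rightarrow> 'a \<times> 'b \<Rightarrow> ('a \<times> 'b) tangent \<Rightarrow> ('a \<times> 'b) tangent \<Rightarrow> real"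
  where "twisted_warped_metric A B \<alpha> f \<omega> \<eta> g1 g2 = (\<lambda>(p, q) x y.
    g1 p (pushforward A fst x) (pushforward A fst y) +
    (f p)\<^sup>2 * (g2 q (pushforward B snd x) (pushforward B snd y) -
              \<eta> q (pushforward B snd x) * \<eta> q (pushforward B snd y)) +
    bar_eta A B \<alpha> \<omega> \<eta> (p, q) x * bar_eta A B \<alpha> \<omega> \<eta> (p, q) y)"

end

theory Submission
  imports Defs
begin

text \<open>
  The Koszul formula for \<open>(0, U)\<close>, \<open>(0, V)\<close> and a product field \<open>(Z, W)\<close> determines the components
  \<open>N\<^sub>1\<close>, \<open>N\<^sub>2\<close> of \<open>N = \<nabla>\<^bsub>(0,U)\<^esub>(0,V)\<close>.  Since \<open>\<xi>\<close> is Killing,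
  \<open>2 \<eta>(\<nabla>\<^sub>U V) = U \<eta>(V) + V \<eta>(U) + \<eta>([U, V])\<close> on the second factor; testing with \<open>(0, \<xi>)\<close> gives
  \<open>\<alpha> \<omega>(N\<^sub>1) + \<eta>(N\<^sub>2) = \<eta>(\<nabla>\<^sub>U V)\<close>, testing with \<open>(Z, 0)\<close> then shows that \<open>N\<^sub>1\<close> is the stated multiple of
  the gradient, and testing with \<open>(0, W)\<close>, where the terms in \<open>\<eta> \<otimes> \<eta>\<close> combine to \<open>d\<eta>\<close>, gives \<open>N\<^sub>2\<close>.

  As tangent vectors are derivations of smooth functions, one has to know that a derivation at a
  point of the product is determined by its two pushforwards and that every tangent vector extends to
  a vector field.  Both follow from Hadamard's lemma
  \<open>h(x) = h(x\<^sub>0) + \<Sum>\<^sub>i (x - x\<^sub>0)\<^sub>i h\<^sub>i(x)\<close> in a chart, cut off by a bump function.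
\<close>

section \<open>Calculus of smooth functions\<close>

text \<open>The square of \<open>bar_eta\<close> couples the two components of the derivative, so
  neither can be read off by testing inside its own factor. As \<open>\<xi>\<close> lies in the
  kernel of g2 - \<eta> \<otimes> \<eta>, the vector (0, \<xi>) sees only that square and isolates
  the coupling. Once its value is known, the terms containing \<alpha> \<omega>(Z) agree on both
  sides, and g1 and g2 determine the components separately. Origin of the coefficients: on vertical
  vectors the metric is f^2 g2 + (1 - f^2) \<eta> \<otimes> \<eta>. Differentiating f^2 along the
  first factor gives the gradient term. The summand with 1 - f^2 leaves d\<eta> terms, that is,
  terms in g2(U, \<phi> W); skew-symmetry of \<phi> reverses their sign and dividing by f^2 gives
  (f^2 - 1) / f^2. The summand along \<xi> compensates in the second component for what the first
  contributes to \<open>bar_eta\<close> through \<alpha> \<omega>.\<close>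

lemma Ck_on_SucI:
  fixes f :: "'d::euclidean_space \<Rightarrow> 'e::euclidean_space"
  assumes "\<And>x. x \<in> S \<Longrightarrow> (f has_derivative f' x) (at x)"
    and "\<And>v. Ck_on k (\<lambda>x. f' x v) S"
    and cong: "\<And>g h :: 'd \<Rightarrow> 'e. (\<And>x. x \<in> S \<Longrightarrow> g x = h x) \<Longrightarrow> Ck_on k g S \<Longrightarrow> Ck_on k h S"
  shows "Ck_on (Suc k) f S"
proof -
  have "frechet_derivative f (at x) = f' x" if "x \<in> S" for x
    using frechet_derivative_at[OF assms(1)[OF that]] by simp
  then have "Ck_on k (\<lambda>x. frechet_derivative f (at x) v) S" for v
    by (intro cong[OF _ assms(2)[of v]]) simp
  then show ?thesis
    using assms(1) by (auto simp: differentiable_def)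
qed

text \<open>\<open>Ck_on_SucI\<close> takes this congruence at level \<open>k\<close> as a premise,
  because it must replace \<open>frechet_derivative f\<close> by a derivative agreeing with it only
  on \<open>S\<close>. Here the induction hypothesis supplies that premise; \<open>Ck_onI\<close>
  then discharges it for good. Openness of \<open>S\<close> lets the values on \<open>S\<close>
  determine the derivatives.\<close>

lemma Ck_on_cong:
  assumes "open S" "\<And>x. x \<in> S \<Longrightarrow> f x = g x" "Ck_on k f S"
  shows "Ck_on k g S"
  using assms(2,3)
proof (induction k arbitrary: f g)
  case 0
  then show ?case by (simp cong: continuous_on_cong)
next
  case (Suc k)
  show ?case
  proof (rule Ck_on_SucI[where f' = "\<lambda>x. frechet_derivative f (at x)"])
    fix x assume x: "x \<in> S"
    have "(f has_derivative frechet_derivative f (at x)) (at x)"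
      using Suc.prems(2) x by (simp add: frechet_derivative_works)
    then show "(g has_derivative frechet_derivative f (at x)) (at x)"
      by (rule has_derivative_transform_within_open[OF _ \<open>open S\<close> x Suc.prems(1)])
  next
    show "Ck_on k (\<lambda>x. frechet_derivative f (at x) v) S" for v
      using Suc.prems(2) by simp
  qed (use Suc.IH in blast)
qed

lemma Ck_onI:
  assumes "open S"
    and "\<And>x. x \<in> S \<Longrightarrow> (f has_derivative f' x) (at x)"
    and "\<And>v. Ck_on k (\<lambda>x. f' x v) S"
  shows "Ck_on (Suc k) f S"
  by (rule Ck_on_SucI[OF assms(2,3)]) (auto intro: Ck_on_cong[OF assms(1)])

lemma Ck_on_has_derivative:
  "Ck_on (Suc k) f S \<Longrightarrow> x \<in> S \<Longrightarrow> (f has_derivative frechet_derivative f (at x)) (at x)"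
  by (simp add: frechet_derivative_works)

lemma Ck_on_frechet: "Ck_on (Suc k) f S \<Longrightarrow> Ck_on k (\<lambda>x. frechet_derivative f (at x) v) S"
  by simp

lemma Ck_on_SucD: "Ck_on (Suc k) f S \<Longrightarrow> Ck_on k f S"
proof (induction k arbitrary: f)
  case 0
  then show ?case
    by (auto intro!: differentiable_imp_continuous_on simp: differentiable_on_def
        differentiable_at_withinI)
next
  case (Suc k)
  then show ?case by (metis Ck_on.simps(2))
qed

lemma Ck_on_subset: "Ck_on k f S \<Longrightarrow> T \<subseteq> S \<Longrightarrow> Ck_on k f T"
  by (induction k arbitrary: f) (auto intro: continuous_on_subset)

lemma Ck_on_locally:
  assumes "\<And>x. x \<in> S \<Longrightarrow> \<exists>T. open T \<and> x \<in> T \<and> Ck_on k f T"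
  shows "Ck_on k f S"
  using assms
proof (induction k arbitrary: f)
  case 0
  then have "\<forall>x\<in>S. isCont f x"
    by (metis Ck_on.simps(1) continuous_on_eq_continuous_at)
  then show ?case by (simp add: continuous_at_imp_continuous_on)
next
  case (Suc k)
  then show ?case by (metis Ck_on.simps(2))
qed

lemma Ck_on_const: "Ck_on k (\<lambda>x. c) S"
  by (induction k arbitrary: c) auto

lemma Ck_on_bounded_linear:
  assumes "bounded_linear f" "open S"
  shows "Ck_on k f S"
proof (cases k)
  case 0
  then show ?thesis using assms by (simp add: linear_continuous_on)
next
  case (Suc k)
  show ?thesis unfolding Suc
    by (rule Ck_onI[OF assms(2), where f' = "\<lambda>_. f"])
      (auto intro: bounded_linear_imp_has_derivative assms Ck_on_const)
qed

lemma Ck_on_add: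
  assumes "open S" "Ck_on k f S" "Ck_on k g S"
  shows "Ck_on k (\<lambda>x. f x + g x) S"
  using assms(2,3)
proof (induction k arbitrary: f g)
  case 0
  then show ?case by (simp add: continuous_on_add)
next
  case (Suc k)
  show ?case
    by (rule Ck_onI[OF assms(1), OF has_derivative_add[OF Ck_on_has_derivative[OF Suc.prems(1)] Ck_on_has_derivative[OF Suc.prems(2)]]])
      (use Suc in \<open>auto\<close>)
qed

lemma Ck_on_scaleR:
  fixes f :: "'a::euclidean_space \<Rightarrow> real"
  assumes "open S" "Ck_on k f S" "Ck_on k g S"
  shows "Ck_on k (\<lambda>x. f x *\<^sub>R g x) S"
  using assms(2,3)
proof (induction k arbitrary: f g)
  case 0
  then show ?case by (simp add: continuous_on_scaleR)
next
  case (Suc k)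
  have "Ck_on k f S" "Ck_on k g S"
    using Suc.prems Ck_on_SucD by blast+
  then show ?case
    by (intro Ck_onI[OF assms(1), OF has_derivative_scaleR[OF Ck_on_has_derivative[OF Suc.prems(1)] Ck_on_has_derivative[OF Suc.prems(2)]]]
        Ck_on_add[OF assms(1)] Suc.IH Ck_on_frechet[OF Suc.prems(1)] Ck_on_frechet[OF Suc.prems(2)])
qed

lemma Ck_on_sum:
  assumes "open S" "\<And>i. i \<in> I \<Longrightarrow> Ck_on k (f i) S"
  shows "Ck_on k (\<lambda>x. \<Sum>i\<in>I. f i x) S"
  using assms(2)
  by (induction I rule: infinite_finite_induct) (simp_all add: Ck_on_const Ck_on_add[OF assms(1)])

lemma Ck_on_linear_comp:
  assumes "bounded_linear L" "open S" "Ck_on k f S"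
  shows "Ck_on k (\<lambda>x. L (f x)) S"
  using assms(3)
proof (induction k arbitrary: f)
  case 0
  then show ?case by (simp add: assms(1) bounded_linear.continuous_on)
next
  case (Suc k)
  show ?case
    by (rule Ck_onI[OF assms(2), OF bounded_linear.has_derivative[OF assms(1) Ck_on_has_derivative[OF Suc.prems(1)]]])
      (use Suc in auto)
qed

lemma linear_sum_Basis:
  fixes L :: "'a::euclidean_space \<Rightarrow> 'b::real_vector"
  assumes "linear L"
  shows "L v = (\<Sum>b\<in>Basis. (v \<bullet> b) *\<^sub>R L b)"
proof -
  have "L v = L (\<Sum>b\<in>Basis. (v \<bullet> b) *\<^sub>R b)"
    by (simp add: euclidean_representation)
  then show ?thesis
    by (simp add: linear_sum[OF assms] linear_scale[OF assms])
qed

text \<open>\<open>Ck_on\<close> speaks of fixed directions only, whereas the chain rule yields a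
  direction that varies with the point. Linearity of the derivative reduces it to the finitely many
  basis directions.\<close>

lemma Ck_on_frechet_apply:
  assumes "open S" "Ck_on k f S" "\<And>b. b \<in> Basis \<Longrightarrow> Ck_on k (\<lambda>x. frechet_derivative g (at (h x)) b) S"
    and "\<And>x. x \<in> S \<Longrightarrow> g differentiable (at (h x))"
  shows "Ck_on k (\<lambda>x. frechet_derivative g (at (h x)) (f x)) S"
proof -
  have "Ck_on k (\<lambda>x. \<Sum>b\<in>Basis. (f x \<bullet> b) *\<^sub>R frechet_derivative g (at (h x)) b) S"
    by (intro Ck_on_sum Ck_on_scaleR assms Ck_on_linear_comp[OF bounded_linear_inner_left])
  moreover have "(\<Sum>b\<in>Basis. (f x \<bullet> b) *\<^sub>R frechet_derivative g (at (h x)) b) =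
      frechet_derivative g (at (h x)) (f x)" if "x \<in> S" for x
    by (rule linear_sum_Basis[OF linear_frechet_derivative[OF assms(4)[OF that]], symmetric])
  ultimately show ?thesis
    by (rule Ck_on_cong[OF assms(1), rotated]) simp
qed

lemma Ck_on_compose:
  assumes "open S" "Ck_on k f S" "Ck_on k g T" "f ` S \<subseteq> T"
  shows "Ck_on k (\<lambda>x. g (f x)) S"
  using assms(2,3)
proof (induction k arbitrary: g)
  case 0
  then show ?case
    using assms(4) by (auto intro: continuous_on_compose2)
next
  case (Suc k)
  have d: "f differentiable at x" "g differentiable at (f x)" if "x \<in> S" for x
    using Suc.prems assms(4) that by auto
  show ?case
  proof (rule Ck_onI[OF assms(1), where f' = "\<lambda>x v. frechet_derivative g (at (f x)) (frechet_derivative f (at x) v)"])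
    fix x assume "x \<in> S"
    then show "((\<lambda>x. g (f x)) has_derivative (\<lambda>v. frechet_derivative g (at (f x)) (frechet_derivative f (at x) v))) (at x)"
      using d[unfolded frechet_derivative_works] by (intro has_derivative_compose[of f _ _ UNIV g])
  next
    fix v
    \<comment> \<open>In the induction f is fixed and g general: a directional derivative takes the
      place of g, while f merely loses one order.\<close>
    have "Ck_on k (\<lambda>x. frechet_derivative g (at (f x)) b) S" for b
      by (rule Suc.IH[OF Ck_on_SucD[OF Suc.prems(1)] Ck_on_frechet[OF Suc.prems(2)]])
    then show "Ck_on k (\<lambda>x. frechet_derivative g (at (f x)) (frechet_derivative f (at x) v)) S"
      by (intro Ck_on_frechet_apply[OF assms(1) Ck_on_frechet[OF Suc.prems(1)]] d)
  qed
qed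

lemma Ck_on_Pair:
  assumes "open S" "Ck_on k f S" "Ck_on k g S"
  shows "Ck_on k (\<lambda>x. (f x, g x)) S"
  using assms(2,3)
proof (induction k arbitrary: f g)
  case 0
  then show ?case by (simp add: continuous_on_Pair)
next
  case (Suc k)
  show ?case
    by (rule Ck_onI[OF assms(1), OF has_derivative_Pair[OF Ck_on_has_derivative[OF Suc.prems(1)] Ck_on_has_derivative[OF Suc.prems(2)]]])
      (use Suc in auto)
qed

text \<open>The derivative of 1/f contains 1/f again, but is wanted only to one order less, which
  the induction hypothesis covers.\<close>

lemma Ck_on_inverse:
  fixes f :: "'a::euclidean_space \<Rightarrow> real"
  assumes "open S" "Ck_on k f S" "\<And>x. x \<in> S \<Longrightarrow> f x \<noteq> 0"
  shows "Ck_on k (\<lambda>x. inverse (f x)) S"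
  using assms(2)
proof (induction k)
  case 0
  then show ?case using assms(3) by (auto intro: continuous_on_inverse)
next
  case (Suc k)
  note IH = Suc.IH[OF Ck_on_SucD[OF Suc.prems]]
  have "Ck_on k (\<lambda>x. (- 1) *\<^sub>R (inverse (f x) *\<^sub>R (frechet_derivative f (at x) v *\<^sub>R inverse (f x)))) S" for v
    by (intro Ck_on_scaleR[OF assms(1)] IH Ck_on_frechet[OF Suc.prems] Ck_on_const)
  then show ?case
    by (intro Ck_onI[OF assms(1), OF Deriv.has_derivative_inverse[OF assms(3) Ck_on_has_derivative[OF Suc.prems]]]) (auto simp: mult.assoc)
qed

lemma convex_segment_point:
  assumes "convex S" "x0 \<in> S" "x \<in> S" "t \<in> {0..1}"
  shows "x0 + t *\<^sub>R (x - x0) \<in> S"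
proof -
  have "(1 - t) *\<^sub>R x0 + t *\<^sub>R x \<in> S"
    using assms by (intro convexD) auto
  then show ?thesis by (simp add: algebra_simps)
qed

text \<open>
  The weight \<open>t ^ m\<close> makes the class of these integrals closed under differentiation in \<open>x\<close>.
\<close>

lemma Ck_on_segment_integral:
  fixes g :: "'a::euclidean_space \<Rightarrow> real"
  assumes S: "open S" "convex S" "x0 \<in> S" and "Ck_on k g S"
  shows "Ck_on k (\<lambda>x. integral {0..1} (\<lambda>t. t ^ m * g (x0 + t *\<^sub>R (x - x0)))) S"
proof -
  note seg = convex_segment_point[OF S(2,3)]
  have cont: "continuous_on (S \<times> {0..1}) (\<lambda>(x, t). t ^ m * g (x0 + t *\<^sub>R (x - x0)))"
    if "continuous_on S g" for g :: "'a \<Rightarrow> real" and m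
    unfolding case_prod_beta
    by (intro continuous_intros continuous_on_compose2[OF that]) (auto simp: seg)
  show ?thesis
    using assms(4)
  proof (induction k arbitrary: g m)
    case 0
    have "continuous_on S (\<lambda>x. integral (cbox 0 1) (\<lambda>t. t ^ m * g (x0 + t *\<^sub>R (x - x0))))"
      using cont[of g m] 0 by (intro integral_continuous_on_param) (auto simp: case_prod_beta)
    then show ?case by simp
  next
    case (Suc k)
    \<comment> \<open>\<open>leibniz_rule\<close> wants the derivative in x as a continuous family
      of bounded linear maps. Assembled from the inner products with basis vectors, its continuity
      reduces to that of the partial derivatives.\<close>
    define L where "L x t = (\<Sum>b\<in>Basis. (t ^ Suc m * frechet_derivative g (at (x0 + t *\<^sub>R (x - x0))) b) *\<^sub>R blinfun_inner_left b)"
      for x t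
    have lin: "linear (frechet_derivative g (at x))" if "x \<in> S" for x
      using Suc.prems that by (auto intro: linear_frechet_derivative)
    have L: "L x t v = t ^ Suc m * frechet_derivative g (at (x0 + t *\<^sub>R (x - x0))) v"
      if "x \<in> S" "t \<in> {0..1}" for x t v
    proof -
      have "frechet_derivative g (at (x0 + t *\<^sub>R (x - x0))) v
          = (\<Sum>b\<in>Basis. (v \<bullet> b) * frechet_derivative g (at (x0 + t *\<^sub>R (x - x0))) b)"
        using linear_sum_Basis[OF lin[OF seg[OF that]], of v] by (simp only: real_scaleR_def)
      then show ?thesis
        unfolding L_def by (simp add: blinfun.sum_left blinfun.scaleR_left sum_distrib_left mult_ac)
    qed
    have der: "((\<lambda>x. t ^ m * g (x0 + t *\<^sub>R (x - x0))) has_derivative blinfun_apply (L x t)) (at x within S)"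
      if "x \<in> S" "t \<in> cbox 0 1" for x t
    proof -
      have t: "t \<in> {0..1}" using that by simp
      have *: "(g has_derivative frechet_derivative g (at (x0 + t *\<^sub>R (x - x0)))) (at (x0 + t *\<^sub>R (x - x0)))"
        using Suc.prems seg[OF that(1) t] by (auto simp: frechet_derivative_works)
      have "((\<lambda>x. x0 + t *\<^sub>R (x - x0)) has_derivative (\<lambda>v. t *\<^sub>R v)) (at x within S)"
        by (auto intro!: derivative_eq_intros)
      from has_derivative_mult_right[OF has_derivative_compose[OF this *], of "t ^ m"]
      have "((\<lambda>x. t ^ m * g (x0 + t *\<^sub>R (x - x0))) has_derivative
          (\<lambda>v. t ^ m * frechet_derivative g (at (x0 + t *\<^sub>R (x - x0))) (t *\<^sub>R v))) (at x within S)" .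
      moreover have "(\<lambda>v. t ^ m * frechet_derivative g (at (x0 + t *\<^sub>R (x - x0))) (t *\<^sub>R v)) = blinfun_apply (L x t)"
        using lin[OF seg[OF that(1) t]] L[OF that(1) t]
        by (auto simp: fun_eq_iff linear_cmul)
      ultimately show ?thesis by simp
    qed
    have cg: "continuous_on S g"
      using Suc.prems by (auto intro!: differentiable_imp_continuous_on simp: differentiable_on_def
        differentiable_at_withinI)
    have cd: "continuous_on S (\<lambda>x. frechet_derivative g (at x) b)" for b
    proof (cases k)
      case (Suc k')
      then show ?thesis using \<open>Ck_on (Suc k) g S\<close>
        by (auto intro!: differentiable_imp_continuous_on simp: differentiable_on_def differentiable_at_withinI)
    qed (use Suc.prems in simp)
    have cL: "continuous_on (S \<times> cbox 0 1) (\<lambda>(x, t). L x t)"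
      unfolding L_def case_prod_beta cbox_interval
      using cont[OF cd, of "Suc m", unfolded case_prod_beta]
      by (intro continuous_on_sum continuous_on_scaleR continuous_on_const)
    have int: "(\<lambda>t. t ^ m * g (x0 + t *\<^sub>R (x - x0))) integrable_on cbox 0 1" if "x \<in> S" for x
      unfolding cbox_interval
      by (intro integrable_continuous_interval continuous_intros continuous_on_compose2[OF cg]) (auto simp: seg that)
    have intL: "L x integrable_on cbox 0 1" if "x \<in> S" for x
    proof -
      have "continuous_on (cbox 0 1) (\<lambda>t. (\<lambda>(x, t). L x t) (x, t))"
        by (rule continuous_on_compose2[OF cL])
          (use that in \<open>auto intro!: continuous_on_Pair continuous_on_const continuous_on_id\<close>)
      then have "continuous_on (cbox 0 1) (L x)" by simp
      then show ?thesis by (rule integrable_continuous)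
    qed
    show ?case
    proof (rule Ck_onI[OF S(1), where f' = "\<lambda>x v. integral {0..1} (\<lambda>t. t ^ Suc m * frechet_derivative g (at (x0 + t *\<^sub>R (x - x0))) v)"])
      fix x assume x: "x \<in> S"
      show "((\<lambda>x. integral {0..1} (\<lambda>t. t ^ m * g (x0 + t *\<^sub>R (x - x0)))) has_derivative
         (\<lambda>v. integral {0..1} (\<lambda>t. t ^ Suc m * frechet_derivative g (at (x0 + t *\<^sub>R (x - x0))) v))) (at x)"
      proof -
        have *: "((\<lambda>x. integral {0..1} (\<lambda>t. t ^ m * g (x0 + t *\<^sub>R (x - x0)))) has_derivative
            blinfun_apply (integral (cbox 0 1) (L x))) (at x)"
          using leibniz_rule[of S 0 1 "\<lambda>x t. t ^ m * g (x0 + t *\<^sub>R (x - x0))" L, OF der int cL x S(2)]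
          unfolding at_within_open[OF x S(1)] cbox_interval .
        have "integral (cbox 0 1) (\<lambda>t. blinfun_apply (L x t) v)
            = integral {0..1} (\<lambda>t. t ^ Suc m * frechet_derivative g (at (x0 + t *\<^sub>R (x - x0))) v)" for v
          unfolding cbox_interval by (rule integral_cong) (rule L[OF x])
        then have "blinfun_apply (integral (cbox 0 1) (L x))
            = (\<lambda>v. integral {0..1} (\<lambda>t. t ^ Suc m * frechet_derivative g (at (x0 + t *\<^sub>R (x - x0))) v))"
          by (intro ext trans[OF blinfun_apply_integral[OF intL[OF x]]])
        with * show ?thesis by (rule has_derivative_eq_rhs)
      qed
    next
      fix v
      show "Ck_on k (\<lambda>x. integral {0..1} (\<lambda>t. t ^ Suc m * frechet_derivative g (at (x0 + t *\<^sub>R (x - x0))) v)) S"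
        using Suc.prems by (intro Suc.IH) simp
    qed
  qed
qed

section \<open>Rules for smooth maps, from the rules for each finite order\<close>

lemma smooth_on_cong:
  assumes "open S" "\<And>x. x \<in> S \<Longrightarrow> f x = g x" "smooth_on S f"
  shows "smooth_on S g"
  using assms Ck_on_cong unfolding smooth_on_def by blast

lemma smooth_on_subset: "smooth_on S f \<Longrightarrow> T \<subseteq> S \<Longrightarrow> smooth_on T f"
  unfolding smooth_on_def using Ck_on_subset by blast

lemma smooth_on_locally:
  assumes "\<And>x. x \<in> S \<Longrightarrow> \<exists>T. open T \<and> x \<in> T \<and> smooth_on T f"
  shows "smooth_on S f"
  using assms unfolding smooth_on_def by (meson Ck_on_locally)

lemma smooth_on_const: "smooth_on S (\<lambda>x. c)"
  by (simp add: smooth_on_def Ck_on_const)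

lemma smooth_on_bounded_linear: "bounded_linear f \<Longrightarrow> open S \<Longrightarrow> smooth_on S f"
  by (simp add: smooth_on_def Ck_on_bounded_linear)

lemma smooth_on_add:
  "open S \<Longrightarrow> smooth_on S f \<Longrightarrow> smooth_on S g \<Longrightarrow> smooth_on S (\<lambda>x. f x + g x)"
  by (simp add: smooth_on_def Ck_on_add)

lemma smooth_on_scaleR:
  "open S \<Longrightarrow> smooth_on S f \<Longrightarrow> smooth_on S g \<Longrightarrow> smooth_on S (\<lambda>x. f x *\<^sub>R g x)"
  by (simp add: smooth_on_def Ck_on_scaleR)

lemma smooth_on_mult:
  fixes f g :: "'a::euclidean_space \<Rightarrow> real"
  shows "open S \<Longrightarrow> smooth_on S f \<Longrightarrow> smooth_on S g \<Longrightarrow> smooth_on S (\<lambda>x. f x * g x)"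
  using smooth_on_scaleR[of S f g] by simp

lemma smooth_on_minus:
  fixes f g :: "'a::euclidean_space \<Rightarrow> real"
  assumes "open S" "smooth_on S f" "smooth_on S g"
  shows "smooth_on S (\<lambda>x. f x - g x)"
  using smooth_on_add[OF assms(1,2) smooth_on_mult[OF assms(1) smooth_on_const assms(3), of "- 1"]]
  by simp

lemma smooth_on_sum:
  "open S \<Longrightarrow> (\<And>i. i \<in> I \<Longrightarrow> smooth_on S (f i)) \<Longrightarrow> smooth_on S (\<lambda>x. \<Sum>i\<in>I. f i x)"
  by (simp add: smooth_on_def Ck_on_sum)

lemma smooth_on_linear_comp:
  "bounded_linear L \<Longrightarrow> open S \<Longrightarrow> smooth_on S f \<Longrightarrow> smooth_on S (\<lambda>x. L (f x))"
  by (simp add: smooth_on_def Ck_on_linear_comp)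

lemma smooth_on_inner_const: "open S \<Longrightarrow> smooth_on S f \<Longrightarrow> smooth_on S (\<lambda>x. f x \<bullet> b)"
  by (rule smooth_on_linear_comp[OF bounded_linear_inner_left])

lemma smooth_on_id: "open S \<Longrightarrow> smooth_on S (\<lambda>x. x)"
  by (rule smooth_on_bounded_linear[OF bounded_linear_ident])

lemma smooth_on_compose:
  "open S \<Longrightarrow> smooth_on S f \<Longrightarrow> smooth_on T g \<Longrightarrow> f ` S \<subseteq> T \<Longrightarrow> smooth_on S (\<lambda>x. g (f x))"
  unfolding smooth_on_def using Ck_on_compose by blast

lemma smooth_on_Pair:
  "open S \<Longrightarrow> smooth_on S f \<Longrightarrow> smooth_on S g \<Longrightarrow> smooth_on S (\<lambda>x. (f x, g x))"
  by (simp add: smooth_on_def Ck_on_Pair)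

lemma smooth_on_fst_comp:
  assumes "open S" "open T" "smooth_on S f"
  shows "smooth_on (S \<times> T) (\<lambda>z. f (fst z))"
  by (rule smooth_on_compose[OF open_Times[OF assms(1,2)] smooth_on_bounded_linear[OF bounded_linear_fst] assms(3)])
    (use assms in \<open>auto intro: open_Times\<close>)

lemma smooth_on_snd_comp:
  assumes "open S" "open T" "smooth_on T f"
  shows "smooth_on (S \<times> T) (\<lambda>z. f (snd z))"
  by (rule smooth_on_compose[OF open_Times[OF assms(1,2)] smooth_on_bounded_linear[OF bounded_linear_snd] assms(3)])
    (use assms in \<open>auto intro: open_Times\<close>)

lemma smooth_on_inverse:
  fixes f :: "'a::euclidean_space \<Rightarrow> real"
  shows "open S \<Longrightarrow> smooth_on S f \<Longrightarrow> (\<And>x. x \<in> S \<Longrightarrow> f x \<noteq> 0) \<Longrightarrow> smooth_on S (\<lambda>x. inverse (f x))"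
  by (simp add: smooth_on_def Ck_on_inverse)

lemma smooth_on_differentiable: "smooth_on S f \<Longrightarrow> x \<in> S \<Longrightarrow> f differentiable (at x)"
  unfolding smooth_on_def by (metis Ck_on.simps(2))

lemma smooth_on_frechet: "smooth_on S f \<Longrightarrow> smooth_on S (\<lambda>x. frechet_derivative f (at x) v)"
  unfolding smooth_on_def by (metis Ck_on.simps(2))

lemma smooth_on_continuous: "smooth_on S f \<Longrightarrow> continuous_on S f"
  unfolding smooth_on_def by (metis Ck_on.simps(1))

lemma smooth_on_frechet_apply:
  assumes "open S" "smooth_on S f" "smooth_on S a"
  shows "smooth_on S (\<lambda>x. frechet_derivative f (at x) (a x))"
  unfolding smooth_on_def
proof
  show "Ck_on k (\<lambda>x. frechet_derivative f (at x) (a x)) S" for k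
    using assms(3) smooth_on_frechet[OF assms(2)] smooth_on_differentiable[OF assms(2)]
    by (intro Ck_on_frechet_apply[of S k a f "\<lambda>x. x", OF assms(1)]) (simp_all only: smooth_on_def)
qed

text \<open>The fundamental theorem of calculus along the segment from \<open>x0\<close> to
  \<open>x\<close>, which convexity keeps inside \<open>S\<close>: \<open>H b x\<close> is the mean
  over this segment of the partial derivative in direction \<open>b\<close>.\<close>

lemma hadamard:
  fixes h :: "'a::euclidean_space \<Rightarrow> real"
  assumes S: "open S" "convex S" "x0 \<in> S" and h: "smooth_on S h"
  obtains H where "\<And>b. smooth_on S (H b)" "\<And>b. H b x0 = frechet_derivative h (at x0) b"
    "\<And>x. x \<in> S \<Longrightarrow> h x = h x0 + (\<Sum>b\<in>Basis. ((x - x0) \<bullet> b) * H b x)"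
proof
  \<comment> \<open>The factor \<open>t ^ 0\<close> gives the integral the shape of
    \<open>Ck_on_segment_integral\<close>.\<close>
  let ?H = "\<lambda>b x. integral {0..1} (\<lambda>t. t ^ 0 * frechet_derivative h (at (x0 + t *\<^sub>R (x - x0))) b)"
  show "smooth_on S (?H b)" for b
    using smooth_on_frechet[OF h] Ck_on_segment_integral[OF S] unfolding smooth_on_def by blast
  show "?H b x0 = frechet_derivative h (at x0) b" for b
    by simp
  fix x assume x: "x \<in> S"
  let ?s = "\<lambda>t. x0 + t *\<^sub>R (x - x0)"
  note seg = convex_segment_point[OF S(2,3) x]
  have der: "((\<lambda>t. h (?s t)) has_vector_derivative frechet_derivative h (at (?s t)) (x - x0)) (at t within {0..1})"
    if "t \<in> {0..1}" for t
  proof -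
    have "(?s has_derivative (\<lambda>u. u *\<^sub>R (x - x0))) (at t within {0..1})"
      by (auto intro!: derivative_eq_intros)
    moreover have *: "(h has_derivative frechet_derivative h (at (?s t))) (at (?s t))"
      using smooth_on_differentiable[OF h seg[OF that]] by (simp add: frechet_derivative_works)
    ultimately have "((\<lambda>t. h (?s t)) has_derivative (\<lambda>u. frechet_derivative h (at (?s t)) (u *\<^sub>R (x - x0)))) (at t within {0..1})"
      by (rule has_derivative_compose)
    then show ?thesis
      unfolding has_vector_derivative_def
      using linear_scale[OF has_derivative_linear[OF *]] by (simp add: fun_eq_iff)
  qed
  have int: "(\<lambda>t. frechet_derivative h (at (?s t)) b) integrable_on {0..1}" for b
    by (intro integrable_continuous_interval continuous_intros
        continuous_on_compose2[OF smooth_on_continuous[OF smooth_on_frechet[OF h]]]) (auto simp: seg)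
  have "h x - h x0 = integral {0..1} (\<lambda>t. frechet_derivative h (at (?s t)) (x - x0))"
    using fundamental_theorem_of_calculus[of 0 1 "\<lambda>t. h (?s t)", OF _ der] by (simp add: integral_unique)
  also have "\<dots> = integral {0..1} (\<lambda>t. \<Sum>b\<in>Basis. ((x - x0) \<bullet> b) * frechet_derivative h (at (?s t)) b)"
    using linear_sum_Basis[OF linear_frechet_derivative[OF smooth_on_differentiable[OF h seg]], of _ "x - x0"]
    by (intro integral_cong) (simp only: real_scaleR_def)
  also have "\<dots> = (\<Sum>b\<in>Basis. ((x - x0) \<bullet> b) * ?H b x)"
    using int by (subst integral_sum) (auto intro!: integrable_on_mult_right)
  finally show "h x = h x0 + (\<Sum>b\<in>Basis. ((x - x0) \<bullet> b) * ?H b x)"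
    by simp
qed

text \<open>The classical function exp(-1/x), continued by 0, with a polynomial in 1/x as a factor:
  the polynomial makes the family closed under differentiation, so that one induction gives all
  orders.\<close>

definition flat :: "real poly \<Rightarrow> real \<Rightarrow> real" where
  "flat P x = (if x > 0 then poly P (inverse x) * exp (- inverse x) else 0)"

lemma poly_times_exp_minus_tendsto_0:
  fixes P :: "real poly"
  shows "((\<lambda>x. poly P x * exp (- x)) \<longlongrightarrow> 0) at_top"
proof -
  have "((\<lambda>x. \<Sum>i\<le>degree P. coeff P i * (x ^ i / exp x)) \<longlongrightarrow> 0) at_top"
    by (intro tendsto_null_sum tendsto_mult_right_zero tendsto_power_div_exp_0)
  then show ?thesis
    by (simp add: poly_altdef sum_distrib_right exp_minus divide_inverse mult.assoc)
qed

lemma flat_tendsto_0: "(flat P \<longlongrightarrow> 0) (at 0)"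
proof -
  have "((\<lambda>x. poly P (inverse x) * exp (- inverse x)) \<longlongrightarrow> 0) (at_right 0)"
    by (rule filterlim_compose[OF poly_times_exp_minus_tendsto_0 filterlim_inverse_at_top_right])
  then have "(flat P \<longlongrightarrow> 0) (at_right 0)"
    by (rule Lim_transform_eventually) (auto simp: flat_def eventually_at_right_less intro!: eventually_mono[OF eventually_at_right_less])
  moreover have "(flat P \<longlongrightarrow> 0) (at_left 0)"
    by (rule Lim_transform_eventually[OF tendsto_const]) (auto simp: flat_def eventually_at_left_field intro!: exI[of _ "-1"])
  ultimately show ?thesis
    by (simp add: filterlim_at_split)
qed

text \<open>With u = 1/x one has d/dx = -u^2 d/du, which turns P(u) exp(-u) into u^2 (P - P')(u)
  exp(-u); the polynomial \<open>[:0, 0, 1:]\<close> is u^2.\<close>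

lemma flat_has_derivative:
  "(flat P has_field_derivative flat ([:0, 0, 1:] * (P - pderiv P)) x) (at x)"
proof (cases x "0 :: real" rule: linorder_cases)
  case less
  have "((\<lambda>x. 0 :: real) has_field_derivative 0) (at x)" by simp
  then have "(flat P has_field_derivative 0) (at x)"
    by (rule has_field_derivative_transform_within_open[of _ _ _ "{..<0}"]) (use less in \<open>auto simp: flat_def\<close>)
  then show ?thesis using less by (simp add: flat_def)
next
  case equal
  \<comment> \<open>The difference quotient at 0 is again a flat function: dividing by y multiplies
    the polynomial by \<open>[:0, 1:]\<close>.\<close>
  have "((\<lambda>y. (flat P y - flat P 0) / (y - 0)) \<longlongrightarrow> 0) (at 0)"
    using flat_tendsto_0[of "[:0, 1:] * P"]
    by (rule Lim_transform_eventually) (auto simp: flat_def divide_inverse eventually_at_filter)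
  then show ?thesis
    unfolding equal has_field_derivative_iff by (simp add: flat_def)
next
  case greater
  have "((\<lambda>x. poly P (inverse x) * exp (- inverse x)) has_field_derivative
      flat ([:0, 0, 1:] * (P - pderiv P)) x) (at x)"
    using greater
    by (auto intro!: derivative_eq_intros DERIV_chain2[OF poly_DERIV] simp: flat_def algebra_simps power2_eq_square)
  then show ?thesis
    by (rule has_field_derivative_transform_within_open[of _ _ _ "{0<..}"]) (use greater in \<open>auto simp: flat_def\<close>)
qed

lemma smooth_on_flat: "smooth_on UNIV (flat P)"
proof -
  have "Ck_on k (flat P) UNIV" for k
  proof (induction k arbitrary: P)
    case 0
    show ?case
      using flat_has_derivative by (auto intro!: continuous_at_imp_continuous_on DERIV_isCont)
  next
    case (Suc k)
    show ?case
    proof (rule Ck_onI)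
      show "(flat P has_derivative (\<lambda>v. v *\<^sub>R flat ([:0, 0, 1:] * (P - pderiv P)) x)) (at x)" for x
        using flat_has_derivative[of P x] by (simp add: has_field_derivative_def mult_commute_abs)
      show "Ck_on k (\<lambda>x. v *\<^sub>R flat ([:0, 0, 1:] * (P - pderiv P)) x) UNIV" for v
        by (intro Ck_on_scaleR Ck_on_const Suc.IH open_UNIV)
    qed simp
  qed
  then show ?thesis by (simp add: smooth_on_def)
qed

text \<open>The function \<open>flat 1\<close> is positive exactly on the positive reals, and r^2 -
  dist^2 is positive exactly on the ball.\<close>

lemma smooth_bump:
  fixes x0 :: "'a::euclidean_space"
  assumes "0 < r"
  obtains \<rho> :: "'a \<Rightarrow> real" where "smooth_on UNIV \<rho>" "\<forall>x\<in>ball x0 r. \<rho> x > 0"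
    "\<forall>x. x \<notin> ball x0 r \<longrightarrow> \<rho> x = 0"
proof -
  \<comment> \<open>The squared distance is written in coordinates so that the rules for sums and
    products give its smoothness.\<close>
  let ?q = "\<lambda>x. r\<^sup>2 - (\<Sum>b\<in>Basis. ((x - x0) \<bullet> b) * ((x - x0) \<bullet> b))"
  have q: "?q x = r\<^sup>2 - (dist x0 x)\<^sup>2" for x
    unfolding dist_norm norm_minus_commute[of x0 x] power2_norm_eq_inner euclidean_inner[of "x - x0" "x - x0"] ..
  have "smooth_on UNIV (\<lambda>x. (x - x0) \<bullet> b)" for b
    unfolding inner_diff_left by (intro smooth_on_minus smooth_on_const smooth_on_inner_const smooth_on_id open_UNIV)
  then have "smooth_on UNIV ?q"
    by (intro smooth_on_minus smooth_on_sum smooth_on_mult smooth_on_const open_UNIV)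
  then have smooth: "smooth_on UNIV (\<lambda>x. flat 1 (?q x))"
    by (rule smooth_on_compose[OF open_UNIV _ smooth_on_flat]) simp
  have "?q x > 0 \<longleftrightarrow> x \<in> ball x0 r" for x
    unfolding q mem_ball diff_gt_0_iff_gt
    using assms power2_less_imp_less[of "dist x0 x" r] power_strict_mono[of "dist x0 x" r 2] by auto
  then have "\<forall>x\<in>ball x0 r. flat 1 (?q x) > 0" "\<forall>x. x \<notin> ball x0 r \<longrightarrow> flat 1 (?q x) = 0"
    by (simp_all add: flat_def del: mem_ball)
  with smooth show thesis by (rule that)
qed


section \<open>Tangent vectors in charts\<close>

lemma manifold_chart:
  assumes "manifold A" "(D, c) \<in> A"
  shows chart_open_domain: "open D"
    and chart_open_image: "open (c ` D)"
    and chart_homeomorphism: "homeomorphism D (c ` D) c (inv_into D c)"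
  using assms by (auto simp: manifold_def)

lemma chart_transition:
  "manifold A \<Longrightarrow> (D, c) \<in> A \<Longrightarrow> (E, e) \<in> A \<Longrightarrow> smooth_on (c ` (D \<inter> E)) (e \<circ> inv_into D c)"
  by (auto simp: manifold_def)

lemma manifold_chart_at:
  assumes "manifold A"
  obtains D c where "(D, c) \<in> A" "x \<in> D"
proof -
  have "x \<in> (\<Union>(D, c)\<in>A. D)" using assms by (simp add: manifold_def)
  then show thesis using that by auto
qed

lemma chart_inverse: "manifold A \<Longrightarrow> (D, c) \<in> A \<Longrightarrow> x \<in> D \<Longrightarrow> inv_into D c (c x) = x"
  using chart_homeomorphism homeomorphism_apply1 by metis

lemma chart_open_subset_image:
  assumes "manifold A" "(D, c) \<in> A" "open W" "W \<subseteq> D"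
  shows "open (c ` W)"
  using homeomorphism_imp_open_map[OF chart_homeomorphism[OF assms(1,2)], of W]
    openin_open_trans chart_open_image[OF assms(1,2)] assms(3,4) open_subset by blast

lemma chart_open_vimage:
  assumes "manifold A" "(D, c) \<in> A" "open S"
  shows "open (D \<inter> c -` S)"
  using homeomorphism_cont1[OF chart_homeomorphism[OF assms(1,2)]] chart_open_domain[OF assms(1,2)] assms(3)
  by (rule continuous_open_preimage)

lemma smooth_funI:
  "(\<And>D c. (D, c) \<in> A \<Longrightarrow> smooth_on (c ` D) (h \<circ> inv_into D c)) \<Longrightarrow> smooth_fun A h"
  by (auto simp: smooth_fun_def)

lemma smooth_funD: "smooth_fun A h \<Longrightarrow> (D, c) \<in> A \<Longrightarrow> smooth_on (c ` D) (h \<circ> inv_into D c)"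
  by (auto simp: smooth_fun_def)

text \<open>One chart near each point suffices: the transition map carries smoothness to every other
  chart that meets it.\<close>

lemma smooth_fun_locally:
  assumes A: "manifold A"
    and local: "\<And>x. \<exists>D c W. (D, c) \<in> A \<and> open W \<and> x \<in> W \<and> W \<subseteq> D \<and> smooth_on (c ` W) (h \<circ> inv_into D c)"
  shows "smooth_fun A h"
  unfolding smooth_fun_def
proof (clarify, rule smooth_on_locally)
  fix E e y assume E: "(E, e) \<in> A" and "y \<in> e ` E"
  then obtain x where x: "y = e x" "x \<in> E" by auto
  obtain D c W where W: "(D, c) \<in> A" "open W" "x \<in> W" "W \<subseteq> D" "smooth_on (c ` W) (h \<circ> inv_into D c)"
    using local by blast
  have T: "open (e ` (W \<inter> E))"
    by (rule chart_open_subset_image[OF A E]) (use W chart_open_domain[OF A E] in auto)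
  have "smooth_on (e ` (W \<inter> E)) (c \<circ> inv_into E e)"
    by (rule smooth_on_subset[OF chart_transition[OF A E W(1)]]) (use W(4) in auto)
  then have "smooth_on (e ` (W \<inter> E)) (\<lambda>z. (h \<circ> inv_into D c) ((c \<circ> inv_into E e) z))"
    by (rule smooth_on_compose[OF T _ W(5)]) (auto simp: chart_inverse[OF A E])
  then have "smooth_on (e ` (W \<inter> E)) (h \<circ> inv_into E e)"
    by (rule smooth_on_cong[OF T, rotated])
      (use W(4) in \<open>auto simp: chart_inverse[OF A E] chart_inverse[OF A W(1)]\<close>)
  then show "\<exists>T. open T \<and> y \<in> T \<and> smooth_on T (h \<circ> inv_into E e)"
    using T x W(3) by blast
qed

lemma smooth_fun_const: "smooth_fun A (\<lambda>x. a)"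
  by (auto simp: smooth_fun_def comp_def smooth_on_const)

lemma smooth_fun_add:
  assumes A: "manifold A" and h: "smooth_fun A h" and k: "smooth_fun A k"
  shows "smooth_fun A (\<lambda>x. h x + k x)"
proof (rule smooth_funI)
  fix D c assume D: "(D, c) \<in> A"
  show "smooth_on (c ` D) ((\<lambda>x. h x + k x) \<circ> inv_into D c)"
    using smooth_on_add[OF chart_open_image[OF A D] smooth_funD[OF h D] smooth_funD[OF k D]]
    by (simp add: comp_def)
qed

lemma smooth_fun_mult:
  assumes A: "manifold A" and h: "smooth_fun A h" and k: "smooth_fun A k"
  shows "smooth_fun A (\<lambda>x. h x * k x)"
proof (rule smooth_funI)
  fix D c assume D: "(D, c) \<in> A"
  show "smooth_on (c ` D) ((\<lambda>x. h x * k x) \<circ> inv_into D c)"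
    using smooth_on_mult[OF chart_open_image[OF A D] smooth_funD[OF h D] smooth_funD[OF k D]]
    by (simp add: comp_def)
qed

lemma smooth_fun_minus:
  assumes A: "manifold A" and h: "smooth_fun A h" and k: "smooth_fun A k"
  shows "smooth_fun A (\<lambda>x. h x - k x)"
proof (rule smooth_funI)
  fix D c assume D: "(D, c) \<in> A"
  show "smooth_on (c ` D) ((\<lambda>x. h x - k x) \<circ> inv_into D c)"
    using smooth_on_minus[OF chart_open_image[OF A D] smooth_funD[OF h D] smooth_funD[OF k D]]
    by (simp add: comp_def)
qed

lemma smooth_fun_sum:
  "manifold A \<Longrightarrow> (\<And>i. i \<in> I \<Longrightarrow> smooth_fun A (h i)) \<Longrightarrow> smooth_fun A (\<lambda>x. \<Sum>i\<in>I. h i x)"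
  by (induction I rule: infinite_finite_induct) (simp_all add: smooth_fun_const smooth_fun_add)

lemma
  assumes "v \<in> tangent_space A p"
  shows tangent_add: "smooth_fun A h \<Longrightarrow> smooth_fun A k \<Longrightarrow> v (\<lambda>x. h x + k x) = v h + v k"
    and tangent_mult: "smooth_fun A h \<Longrightarrow> smooth_fun A k \<Longrightarrow> v (\<lambda>x. h x * k x) = h p * v k + k p * v h"
    and tangent_cmult: "smooth_fun A h \<Longrightarrow> v (\<lambda>x. a * h x) = a * v h"
    and tangent_nonsmooth: "\<not> smooth_fun A h \<Longrightarrow> v h = 0"
  using assms unfolding tangent_space_def by blast+

lemma tangent_const:
  assumes "v \<in> tangent_space A p"
  shows "v (\<lambda>x. a) = 0"
proof -
  have "v (\<lambda>x. 1) = 0"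
    using tangent_mult[OF assms smooth_fun_const[of A 1] smooth_fun_const[of A 1]] by simp
  then show ?thesis
    using tangent_cmult[OF assms smooth_fun_const[of A 1], of a] by simp
qed

lemma tangent_minus:
  assumes A: "manifold A" and v: "v \<in> tangent_space A p" and hk: "smooth_fun A h" "smooth_fun A k"
  shows "v (\<lambda>x. h x - k x) = v h - v k"
proof -
  have "v (\<lambda>x. h x + (- 1) * k x) = v h + v (\<lambda>x. (- 1) * k x)"
    by (rule tangent_add[OF v hk(1) smooth_fun_mult[OF A smooth_fun_const hk(2)]])
  then show ?thesis
    unfolding tangent_cmult[OF v hk(2)] by simp
qed

lemma tangent_sum:
  assumes A: "manifold A" and v: "v \<in> tangent_space A p" and "\<And>i. i \<in> I \<Longrightarrow> smooth_fun A (h i)"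
  shows "v (\<lambda>x. \<Sum>i\<in>I. h i x) = (\<Sum>i\<in>I. v (h i))"
  using assms(3)
  by (induction I rule: infinite_finite_induct)
    (simp_all add: tangent_const[OF v] tangent_add[OF v] smooth_fun_sum[OF A])

lemma tangent_zero: "0 \<in> tangent_space A p"
  by (simp add: tangent_space_def)

lemma tangent_lincomb:
  "v \<in> tangent_space A p \<Longrightarrow> w \<in> tangent_space A p \<Longrightarrow> a *\<^sub>R v + b *\<^sub>R w \<in> tangent_space A p"
  unfolding tangent_space_def by (simp add: algebra_simps)

lemma tangent_scaleR: "v \<in> tangent_space A p \<Longrightarrow> a *\<^sub>R v \<in> tangent_space A p"
  using tangent_lincomb[of v A p v a 0] by simp

lemma tangent_plus:
  "v \<in> tangent_space A p \<Longrightarrow> w \<in> tangent_space A p \<Longrightarrow> v + w \<in> tangent_space A p"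
  using tangent_lincomb[of v A p w 1 1] by simp

lemma tangent_diff:
  "v \<in> tangent_space A p \<Longrightarrow> w \<in> tangent_space A p \<Longrightarrow> v - w \<in> tangent_space A p"
  using tangent_lincomb[of v A p w 1 "- 1"] by simp

lemma tangent_eqI:
  assumes "v \<in> tangent_space A p" "w \<in> tangent_space A p" "\<And>h. smooth_fun A h \<Longrightarrow> v h = w h"
  shows "v = w"
  using assms tangent_nonsmooth by (metis ext)

lemma vfieldsD:
  "X \<in> vfields A \<Longrightarrow> X p \<in> tangent_space A p"
  "X \<in> vfields A \<Longrightarrow> smooth_fun A h \<Longrightarrow> smooth_fun A (\<lambda>p. X p h)"
  by (auto simp: vfields_def)

text \<open>The vector with components \<open>a\<close> in the coordinate frame of the chart
  \<open>c\<close>; the value 0 on non-smooth functions follows the convention of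
  \<open>tangent_space\<close>.\<close>

definition coord_vec :: "('a, 'd::euclidean_space) atlas \<Rightarrow> 'a set \<Rightarrow> ('a \<Rightarrow> 'd) \<Rightarrow> 'a \<Rightarrow> 'd \<Rightarrow> 'a tangent"
  where "coord_vec A D c p a =
    (\<lambda>h. if smooth_fun A h then frechet_derivative (h \<circ> inv_into D c) (at (c p)) a else 0)"

lemma coord_vec_tangent:
  assumes A: "manifold A" "(D, c) \<in> A" "p \<in> D"
  shows "coord_vec A D c p a \<in> tangent_space A p"
proof -
  have d: "((h \<circ> inv_into D c) has_derivative frechet_derivative (h \<circ> inv_into D c) (at (c p))) (at (c p))"
    if "smooth_fun A h" for h
    using smooth_on_differentiable[OF smooth_funD[OF that A(2)]] A(3) by (simp add: frechet_derivative_works)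
  show ?thesis
    unfolding tangent_space_def
  proof (intro CollectI conjI allI impI)
    fix h k assume h: "smooth_fun A h" and k: "smooth_fun A k"
    show "coord_vec A D c p a (\<lambda>x. h x + k x) = coord_vec A D c p a h + coord_vec A D c p a k"
      using fun_cong[OF frechet_derivative_at[OF has_derivative_add[OF d[OF h] d[OF k]]], of a, symmetric]
      by (simp add: coord_vec_def h k smooth_fun_add[OF A(1)] comp_def)
    show "coord_vec A D c p a (\<lambda>x. h x * k x) = h p * coord_vec A D c p a k + k p * coord_vec A D c p a h"
      using fun_cong[OF frechet_derivative_at[OF has_derivative_mult[OF d[OF h] d[OF k]]], of a, symmetric]
      by (simp add: coord_vec_def h k smooth_fun_mult[OF A(1)] chart_inverse[OF A] comp_def)
  next
    fix b h assume h: "smooth_fun A h"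
    show "coord_vec A D c p a (\<lambda>x. b * h x) = b * coord_vec A D c p a h"
      using fun_cong[OF frechet_derivative_at[OF has_derivative_mult_right[OF d[OF h], of b]], of a, symmetric]
      by (simp add: coord_vec_def h smooth_fun_mult[OF A(1) smooth_fun_const] comp_def)
  qed (simp add: coord_vec_def)
qed

text \<open>Hadamard's lemma works on the convex set \<open>S\<close> of coordinates; the compact
  \<open>K\<close> carries the cut-off \<open>\<rho>\<close>, so that functions on \<open>S\<close>
  multiplied by \<open>\<rho>\<close> extend by 0 to the whole manifold.\<close>

locale chart_bump =
  fixes A :: "('a::{t2_space, second_countable_topology}, 'd::euclidean_space) atlas"
    and D :: "'a set" and c :: "'a \<Rightarrow> 'd" and S K :: "'d set" and \<rho> :: "'d \<Rightarrow> real"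
  assumes manifold: "manifold A" and chart: "(D, c) \<in> A"
    and open_S: "open S" and convex_S: "convex S" and S_sub: "S \<subseteq> c ` D"
    and compact_K: "compact K" and K_sub: "K \<subseteq> S"
    and smooth_bump: "smooth_on UNIV \<rho>" and bump_0: "x \<notin> K \<Longrightarrow> \<rho> x = 0"
begin

definition chart_ext :: "('d \<Rightarrow> real) \<Rightarrow> 'a \<Rightarrow> real"
  where "chart_ext u = (\<lambda>x. if x \<in> D \<and> c x \<in> S then u (c x) else 0)"

lemma smooth_chart_ext:
  assumes u: "smooth_on S u" and u0: "\<And>x. x \<in> S - K \<Longrightarrow> u x = 0"
  shows "smooth_fun A (chart_ext u)"
proof (rule smooth_fun_locally[OF manifold])
  fix x
  have inv: "inv_into D c (c x) = x" if "x \<in> D" for x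
    by (rule chart_inverse[OF manifold chart that])
  show "\<exists>D c W. (D, c) \<in> A \<and> open W \<and> x \<in> W \<and> W \<subseteq> D \<and> smooth_on (c ` W) (chart_ext u \<circ> inv_into D c)"
  proof (cases "x \<in> D \<and> c x \<in> S")
    case True
    let ?W = "D \<inter> c -` S"
    have W: "open ?W" by (rule chart_open_vimage[OF manifold chart open_S])
    have "smooth_on (c ` ?W) u"
      by (rule smooth_on_subset[OF u]) auto
    then have "smooth_on (c ` ?W) (chart_ext u \<circ> inv_into D c)"
      by (rule smooth_on_cong[rotated 2])
        (auto simp: chart_ext_def inv intro: chart_open_subset_image[OF manifold chart W])
    then show ?thesis using True W chart by blast
  next
    case False
    \<comment> \<open>Off \<open>?L\<close> the extension vanishes. This set is compact, hence
      closed as the manifold is Hausdorff, so \<open>x\<close> has a whole neighbourhood on which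
      the extension is 0.\<close>
    let ?L = "inv_into D c ` K"
    have KD: "K \<subseteq> c ` D" using K_sub S_sub by blast
    have "compact ?L"
      using homeomorphism_cont2[OF chart_homeomorphism[OF manifold chart]] KD compact_K
      by (auto intro: compact_continuous_image continuous_on_subset)
    then have L: "closed ?L" by (rule compact_imp_closed)
    have xL: "x \<notin> ?L"
      using False KD K_sub inv by (auto simp: f_inv_into_f inv_into_into subset_iff)
    obtain E e where E: "(E, e) \<in> A" "x \<in> E"
      by (rule manifold_chart_at[OF manifold])
    let ?W = "E - ?L"
    have W: "open ?W"
      using chart_open_domain[OF manifold E(1)] L by (rule open_Diff)
    have 0: "chart_ext u z = 0" if "z \<in> ?W" for z
    proof -
      have "c z \<notin> K" if "z \<in> D"
        using \<open>z \<in> ?W\<close> inv[OF that] by force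
      then show ?thesis using u0 by (auto simp: chart_ext_def)
    qed
    have "smooth_on (e ` ?W) (chart_ext u \<circ> inv_into E e)"
      by (rule smooth_on_cong[OF _ _ smooth_on_const[of _ 0]])
        (use 0 chart_open_subset_image[OF manifold E(1) W] chart_inverse[OF manifold E(1)] in auto)
    then show ?thesis using E W xL by blast
  qed
qed

lemma smooth_chart_ext_bump:
  assumes "smooth_on S u"
  shows "smooth_fun A (chart_ext (\<lambda>x. \<rho> x * u x))"
  by (intro smooth_chart_ext smooth_on_mult[OF open_S] assms smooth_on_subset[OF smooth_bump])
    (auto simp: bump_0)

text \<open>A derivation at \<open>p\<close> sees of a product of cut-off coordinate and Hadamard
  coefficient only the value of the coefficient at \<open>p\<close>, since the coordinate is 0
  there. Thus \<open>v\<close> is determined by its values on the finitely many cut-off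
  coordinates.\<close>

lemma tangent_hadamard:
  assumes p: "p \<in> D" "c p \<in> S" and \<rho>: "\<rho> (c p) \<noteq> 0"
    and v: "v \<in> tangent_space A p" and h: "smooth_fun A h"
  shows "\<rho> (c p) * v h = frechet_derivative (h \<circ> inv_into D c) (at (c p))
    (\<Sum>b\<in>Basis. v (chart_ext (\<lambda>x. \<rho> x * ((x - c p) \<bullet> b))) *\<^sub>R b)"
proof -
  let ?h = "h \<circ> inv_into D c" and ?y = "c p"
  let ?x = "\<lambda>b. chart_ext (\<lambda>x. \<rho> x * ((x - c p) \<bullet> b))"
  have hS: "smooth_on S ?h"
    by (rule smooth_on_subset[OF smooth_funD[OF h chart] S_sub])
  obtain H where H: "\<And>b. smooth_on S (H b)" "\<And>b. H b ?y = frechet_derivative ?h (at ?y) b"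
    "\<And>x. x \<in> S \<Longrightarrow> ?h x = ?h ?y + (\<Sum>b\<in>Basis. ((x - ?y) \<bullet> b) * H b x)"
    using hadamard[OF open_S convex_S p(2) hS] by blast
  define X where "X = ?x"
  define G where "G b = chart_ext (\<lambda>x. \<rho> x * H b x)" for b
  define r where "r = chart_ext (\<lambda>x. \<rho> x * 1)"
  have sx: "smooth_fun A (X b)" for b
    unfolding inner_diff_left X_def
    by (intro smooth_chart_ext_bump smooth_on_minus smooth_on_inner_const smooth_on_const smooth_on_id open_S)
  have sG: "smooth_fun A (G b)" for b
    unfolding G_def by (intro smooth_chart_ext_bump H)
  have sr: "smooth_fun A r"
    unfolding r_def by (intro smooth_chart_ext_bump smooth_on_const)
  have srr: "smooth_fun A (\<lambda>x. r x * r x)"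
    by (rule smooth_fun_mult[OF manifold sr sr])
  have at_p: "r p = \<rho> ?y" "X b p = 0" "G b p = \<rho> ?y * H b ?y" for b
    using p by (simp_all add: r_def X_def G_def chart_ext_def)
  \<comment> \<open>One factor \<open>r\<close> for each factor of \<open>(x - c p)\<^sub>b H\<^sub>b\<close>, so that both extend to the manifold.\<close>
  have "r x * r x * h x = h p * (r x * r x) + (\<Sum>b\<in>Basis. X b x * G b x)" for x
  proof (cases "x \<in> D \<and> c x \<in> S")
    case True
    then have "h x = h p + (\<Sum>b\<in>Basis. ((c x - ?y) \<bullet> b) * H b (c x))"
      using H(3)[of "c x"] p(1) by (simp add: chart_inverse[OF manifold chart])
    then have "\<rho> (c x) * \<rho> (c x) * h x = \<rho> (c x) * \<rho> (c x) * (h p + (\<Sum>b\<in>Basis. ((c x - ?y) \<bullet> b) * H b (c x)))"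
      by simp
    then show ?thesis
      using True by (simp add: r_def X_def G_def chart_ext_def distrib_left sum_distrib_left mult_ac)
  qed (auto simp: r_def X_def chart_ext_def)
  then have "v (\<lambda>x. r x * r x * h x) = v (\<lambda>x. h p * (r x * r x) + (\<Sum>b\<in>Basis. X b x * G b x))"
    by presburger
  also have "\<dots> = h p * v (\<lambda>x. r x * r x) + (\<Sum>b\<in>Basis. v (\<lambda>x. X b x * G b x))"
    unfolding tangent_add[OF v smooth_fun_mult[OF manifold smooth_fun_const srr]
        smooth_fun_sum[OF manifold smooth_fun_mult[OF manifold sx sG]]]
      tangent_cmult[OF v srr] tangent_sum[OF manifold v smooth_fun_mult[OF manifold sx sG]] ..
  also have "(\<Sum>b\<in>Basis. v (\<lambda>x. X b x * G b x)) = \<rho> ?y * (\<Sum>b\<in>Basis. H b ?y * v (X b))"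
    unfolding tangent_mult[OF v sx sG] by (simp add: at_p sum_distrib_left mult.assoc)
  \<comment> \<open>The Leibniz rule on the left produces
    \<open>h p * v (\<lambda>x. r x * r x)\<close> as well; it cancels, and with it the derivative
    of the cut-off.\<close>
  finally have "\<rho> ?y * \<rho> ?y * v h = \<rho> ?y * (\<Sum>b\<in>Basis. H b ?y * v (X b))"
    unfolding tangent_mult[OF v srr h] by (simp add: at_p)
  then have "\<rho> ?y * v h = (\<Sum>b\<in>Basis. H b ?y * v (X b))"
    using \<rho> by simp
  also have "\<dots> = frechet_derivative ?h (at ?y) (\<Sum>b\<in>Basis. v (X b) *\<^sub>R b)"
    using linear_frechet_derivative[OF smooth_on_differentiable[OF hS p(2)]]
    by (simp add: H(2) linear_sum linear_scale mult.commute)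
  finally show ?thesis unfolding X_def .
qed

end

lemma chart_bump_at:
  assumes A: "manifold (A :: ('a::{t2_space, second_countable_topology}, 'd::euclidean_space) atlas)"
    "(D, c) \<in> A" "p \<in> D"
  obtains S K \<rho> where "chart_bump A D c S K \<rho>" "c p \<in> S" "\<rho> (c p) > 0"
proof -
  obtain r where r: "r > 0" "ball (c p) r \<subseteq> c ` D"
    using chart_open_image[OF A(1,2)] A(3) openE by blast
  \<comment> \<open>With half the radius the support fits into a closed ball inside the open ball
    that serves as \<open>S\<close>.\<close>
  obtain \<rho> :: "'d \<Rightarrow> real" where \<rho>: "smooth_on UNIV \<rho>" "\<forall>x\<in>ball (c p) (r/2). \<rho> x > 0"
    "\<forall>x. x \<notin> ball (c p) (r/2) \<longrightarrow> \<rho> x = 0"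
    by (rule smooth_bump[OF half_gt_zero[OF r(1)]])
  have "chart_bump A D c (ball (c p) r) (cball (c p) (r/2)) \<rho>"
    by standard (use A r \<rho> in auto)
  then show thesis
    by (rule that) (use r \<rho>(2) in auto)
qed

text \<open>The components are the values of \<open>v\<close> on the cut-off coordinates centred at
  \<open>c p\<close>, divided by the cut-off at that point.\<close>

lemma tangent_coord_vec:
  assumes A: "manifold A" "(D, c) \<in> A" "p \<in> D" and v: "v \<in> tangent_space A p"
  obtains a where "v = coord_vec A D c p a"
proof -
  obtain S K \<rho> where "chart_bump A D c S K \<rho>" and p: "c p \<in> S" "\<rho> (c p) > 0"
    by (rule chart_bump_at[OF A])
  interpret chart_bump A D c S K \<rho> by fact
  let ?a = "(\<Sum>b\<in>Basis. v (chart_ext (\<lambda>x. \<rho> x * ((x - c p) \<bullet> b))) *\<^sub>R b)"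
  have "v = coord_vec A D c p (inverse (\<rho> (c p)) *\<^sub>R ?a)"
  proof (rule tangent_eqI[OF v coord_vec_tangent[OF A]])
    fix h assume h: "smooth_fun A h"
    have "linear (frechet_derivative (h \<circ> inv_into D c) (at (c p)))"
      by (rule linear_frechet_derivative[OF smooth_on_differentiable[OF smooth_funD[OF h A(2)]]]) (use A in auto)
    then have "coord_vec A D c p (inverse (\<rho> (c p)) *\<^sub>R ?a) h = inverse (\<rho> (c p)) * (\<rho> (c p) * v h)"
      using tangent_hadamard[OF A(3) p(1) _ v h] p(2)
      by (simp add: coord_vec_def h linear_scale del: scaleR_sum_right)
    then show "v h = coord_vec A D c p (inverse (\<rho> (c p)) *\<^sub>R ?a) h"
      using p(2) by simp
  qed
  then show thesis by (rule that)
qed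

text \<open>The field has constant components in a chart, times a cut-off normalized to 1 at
  \<open>p\<close>. It turns hypotheses quantified over vector fields into statements about single
  tangent vectors.\<close>

lemma tangent_extend:
  assumes A: "manifold (A :: ('a::{t2_space, second_countable_topology}, 'd::euclidean_space) atlas)"
    and v: "v \<in> tangent_space A p"
  obtains X where "X \<in> vfields A" "X p = v"
proof -
  obtain D c where D: "(D, c) \<in> A" "p \<in> D"
    by (rule manifold_chart_at[OF A])
  obtain a where a: "v = coord_vec A D c p a"
    by (rule tangent_coord_vec[OF A D v])
  obtain S K \<rho> where "chart_bump A D c S K \<rho>" and p: "c p \<in> S" "\<rho> (c p) > 0"
    by (rule chart_bump_at[OF A D])
  interpret chart_bump A D c S K \<rho> by fact
  define X where "X x = (if x \<in> D \<and> c x \<in> S then (\<rho> (c x) / \<rho> (c p)) *\<^sub>R coord_vec A D c x a else 0)" for x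
  have "X \<in> vfields A"
    unfolding vfields_def
  proof (intro CollectI conjI allI impI)
    show "X x \<in> tangent_space A x" for x
      by (simp add: X_def tangent_zero tangent_scaleR coord_vec_tangent A D)
    fix h assume h: "smooth_fun A h"
    have "(\<lambda>x. X x h) = chart_ext (\<lambda>y. \<rho> y * (inverse (\<rho> (c p)) * frechet_derivative (h \<circ> inv_into D c) (at y) a))"
      by (auto simp: X_def chart_ext_def coord_vec_def h fun_eq_iff divide_inverse)
    moreover have "smooth_fun A \<dots>"
      by (intro smooth_chart_ext_bump smooth_on_mult[OF open_S] smooth_on_const smooth_on_frechet
          smooth_on_subset[OF smooth_funD[OF h D(1)] S_sub])
    ultimately show "smooth_fun A (\<lambda>x. X x h)" by simp
  qed
  moreover have "X p = v"
    using p D(2) by (simp add: X_def a)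
  ultimately show thesis by (rule that)
qed

text \<open>A field is only known to map smooth functions to smooth functions; its components in a
  chart are smooth because they can be computed from its values on finitely many globally smooth
  functions.\<close>

lemma vfield_local:
  assumes A: "manifold (A :: ('a::{t2_space, second_countable_topology}, 'd::euclidean_space) atlas)"
    "(D, c) \<in> A" "p \<in> D" and X: "X \<in> vfields A"
  obtains W a where "open W" "p \<in> W" "W \<subseteq> D" "smooth_on (c ` W) a"
    "\<forall>x\<in>W. X x = coord_vec A D c x (a (c x))"
proof -
  obtain S K \<rho> where "chart_bump A D c S K \<rho>" and p: "c p \<in> S" "\<rho> (c p) > 0"
    by (rule chart_bump_at[OF A])
  interpret chart_bump A D c S K \<rho> by fact
  \<comment> \<open>On \<open>W\<close> the cut-off is positive, so the components can be divided by
    it.\<close>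
  define W where "W = D \<inter> c -` (S \<inter> \<rho> -` {0<..})"
  have "open (\<rho> -` {0<..})"
    using smooth_on_continuous[OF smooth_bump] by (intro continuous_open_vimage) (auto simp: continuous_on_eq_continuous_at)
  then have W: "open W"
    unfolding W_def by (intro chart_open_vimage[OF A(1,2)] open_Int open_S)
  \<comment> \<open>The components at \<open>x\<close> come from cut-off coordinates centred at
    \<open>c x\<close>, which vary with \<open>x\<close>. By linearity they are combinations of
    \<open>u b\<close> and \<open>u0\<close>, the values of the field on functions independent of
    \<open>x\<close>.\<close>
  define u where "u b = (\<lambda>x. X x (chart_ext (\<lambda>y. \<rho> y * (y \<bullet> b)))) \<circ> inv_into D c" for b
  define u0 where "u0 = (\<lambda>x. X x (chart_ext (\<lambda>y. \<rho> y * 1))) \<circ> inv_into D c"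
  define a where "a y = (\<Sum>b\<in>Basis. (inverse (\<rho> y) * (u b y - (y \<bullet> b) * u0 y)) *\<^sub>R b)" for y
  have s: "smooth_fun A (chart_ext (\<lambda>y. \<rho> y * (y \<bullet> b)))" for b
    by (intro smooth_chart_ext_bump smooth_on_inner_const smooth_on_id open_S)
  have s0: "smooth_fun A (chart_ext (\<lambda>y. \<rho> y * 1))"
    by (intro smooth_chart_ext_bump smooth_on_const)
  have cW: "open (c ` W)"
    by (rule chart_open_subset_image[OF A(1,2) W]) (simp add: W_def)
  have "smooth_on (c ` W) (u b)" for b
    unfolding u_def by (rule smooth_on_subset[OF smooth_funD[OF vfieldsD(2)[OF X s] A(2)]]) (auto simp: W_def)
  moreover have "smooth_on (c ` W) u0"
    unfolding u0_def by (rule smooth_on_subset[OF smooth_funD[OF vfieldsD(2)[OF X s0] A(2)]]) (auto simp: W_def)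
  ultimately have sa: "smooth_on (c ` W) a"
    unfolding a_def
    by (intro smooth_on_sum smooth_on_scaleR smooth_on_mult smooth_on_minus smooth_on_inverse
        smooth_on_inner_const smooth_on_id smooth_on_const cW smooth_on_subset[OF smooth_bump])
      (auto simp: W_def)
  have eq: "X x = coord_vec A D c x (a (c x))" if "x \<in> W" for x
  proof (rule tangent_eqI[OF vfieldsD(1)[OF X] coord_vec_tangent[OF A(1,2)]])
    show xD: "x \<in> D" using that by (simp add: W_def)
    have xS: "c x \<in> S" and \<rho>: "\<rho> (c x) \<noteq> 0" using that by (auto simp: W_def)
    have Xx: "X x \<in> tangent_space A x" by (rule vfieldsD(1)[OF X])
    have "X x (chart_ext (\<lambda>y. \<rho> y * ((y - c x) \<bullet> b))) = u b (c x) - (c x \<bullet> b) * u0 (c x)" for b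
    proof -
      have "chart_ext (\<lambda>y. \<rho> y * ((y - c x) \<bullet> b)) =
          (\<lambda>z. chart_ext (\<lambda>y. \<rho> y * (y \<bullet> b)) z - (c x \<bullet> b) * chart_ext (\<lambda>y. \<rho> y * 1) z)"
        by (auto simp: chart_ext_def fun_eq_iff inner_diff_left algebra_simps)
      then have "X x (chart_ext (\<lambda>y. \<rho> y * ((y - c x) \<bullet> b))) =
          X x (chart_ext (\<lambda>y. \<rho> y * (y \<bullet> b))) - (c x \<bullet> b) * X x (chart_ext (\<lambda>y. \<rho> y * 1))"
        by (simp only: tangent_minus[OF A(1) Xx s smooth_fun_mult[OF A(1) smooth_fun_const s0]]
            tangent_cmult[OF Xx s0])
      then show ?thesis
        by (simp add: u_def u0_def chart_inverse[OF A(1,2) xD])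
    qed
    then have a: "a (c x) = inverse (\<rho> (c x)) *\<^sub>R (\<Sum>b\<in>Basis. X x (chart_ext (\<lambda>y. \<rho> y * ((y - c x) \<bullet> b))) *\<^sub>R b)"
      by (simp add: a_def scaleR_sum_right)
    fix h assume h: "smooth_fun A h"
    have "linear (frechet_derivative (h \<circ> inv_into D c) (at (c x)))"
      by (rule linear_frechet_derivative[OF smooth_on_differentiable[OF smooth_funD[OF h A(2)]]]) (use xD in auto)
    then have "coord_vec A D c x (a (c x)) h = inverse (\<rho> (c x)) * (\<rho> (c x) * X x h)"
      unfolding a tangent_hadamard[OF xD xS \<rho> Xx h]
      by (simp add: coord_vec_def h linear_scale del: scaleR_sum_right)
    then show "X x h = coord_vec A D c x (a (c x)) h"
      using \<rho> by simp
  qed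
  show thesis
    by (rule that[OF W _ _ sa]) (use p A(3) eq in \<open>auto simp: W_def\<close>)
qed


section \<open>The product manifold\<close>

lemma prod_atlasE:
  assumes "(F, k) \<in> prod_atlas A B"
  obtains D c E e where "F = D \<times> E" "k = map_prod c e" "(D, c) \<in> A" "(E, e) \<in> B"
  using assms by (auto simp: prod_atlas_def)

lemma prod_atlasI: "(D, c) \<in> A \<Longrightarrow> (E, e) \<in> B \<Longrightarrow> (D \<times> E, map_prod c e) \<in> prod_atlas A B"
  by (auto simp: prod_atlas_def)

lemma map_prod_image_Times: "map_prod c e ` (D \<times> E) = c ` D \<times> e ` E"
  by force

context
  fixes A :: "('a::{t2_space, second_countable_topology}, 'd::euclidean_space) atlas"
    and B :: "('b::{t2_space, second_countable_topology}, 'e::euclidean_space) atlas"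
  assumes A: "manifold A" and B: "manifold B"
begin

lemma prod_chart_inverse:
  assumes "(D, c) \<in> A" "(E, e) \<in> B" "y \<in> c ` D" "z \<in> e ` E"
  shows "inv_into (D \<times> E) (map_prod c e) (y, z) = (inv_into D c y, inv_into E e z)"
proof -
  have "inj_on (map_prod c e) (D \<times> E)"
    by (intro map_prod_inj_on inj_on_inverseI[of _ "inv_into D c"] inj_on_inverseI[of _ "inv_into E e"]
        chart_inverse[OF A assms(1)] chart_inverse[OF B assms(2)])
  then have "inv_into (D \<times> E) (map_prod c e) (map_prod c e (inv_into D c y, inv_into E e z))
      = (inv_into D c y, inv_into E e z)"
    by (rule inv_into_f_f) (use assms in \<open>auto intro: inv_into_into\<close>)
  then show ?thesis
    using assms(3,4) by (simp add: f_inv_into_f)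
qed

lemma manifold_prod: "manifold (prod_atlas A B)"
  unfolding manifold_def
proof (intro conjI)
  have "x \<in> (\<Union>(D, c)\<in>prod_atlas A B. D)" for x
  proof -
    obtain D c where "(D, c) \<in> A" "fst x \<in> D" by (rule manifold_chart_at[OF A])
    moreover obtain E e where "(E, e) \<in> B" "snd x \<in> E" by (rule manifold_chart_at[OF B])
    ultimately have "(D \<times> E, map_prod c e) \<in> prod_atlas A B" "x \<in> D \<times> E"
      by (auto intro: prod_atlasI simp: mem_Times_iff)
    then show ?thesis by (intro UN_I[of "(D \<times> E, map_prod c e)"]) simp_all
  qed
  then show "(\<Union>(D, c)\<in>prod_atlas A B. D) = UNIV" by blast
next
  show "\<forall>(F, k)\<in>prod_atlas A B. open F \<and> open (k ` F) \<and> homeomorphism F (k ` F) k (inv_into F k)"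
  proof clarify
    fix F k assume "(F, k) \<in> prod_atlas A B"
    then obtain D c E e where F: "F = D \<times> E" "k = map_prod c e" and D: "(D, c) \<in> A" and E: "(E, e) \<in> B"
      by (rule prod_atlasE)
    note hD = chart_homeomorphism[OF A D] and hE = chart_homeomorphism[OF B E]
    have "homeomorphism F (k ` F) k (inv_into F k)"
    proof (rule homeomorphismI)
      show "continuous_on F k"
        unfolding F map_prod_def case_prod_beta
        by (intro continuous_on_Pair continuous_on_compose2[OF homeomorphism_cont1[OF hD]]
            continuous_on_compose2[OF homeomorphism_cont1[OF hE]] continuous_on_fst continuous_on_snd continuous_on_id) auto
      have "continuous_on (c ` D \<times> e ` E) (\<lambda>z. (inv_into D c (fst z), inv_into E e (snd z)))"
        by (intro continuous_on_Pair continuous_on_compose2[OF homeomorphism_cont2[OF hD]]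
            continuous_on_compose2[OF homeomorphism_cont2[OF hE]] continuous_on_fst continuous_on_snd continuous_on_id) auto
      then show "continuous_on (k ` F) (inv_into F k)"
        unfolding F map_prod_image_Times
        by (rule continuous_on_eq) (auto simp: prod_chart_inverse[OF D E])
      show "k ` F \<subseteq> k ` F" ..
      show "inv_into F k ` k ` F \<subseteq> F" by (simp add: image_subset_iff inv_into_into)
      show "inv_into F k (k x) = x" if "x \<in> F" for x
        using that by (auto simp: F prod_chart_inverse[OF D E] chart_inverse[OF A D] chart_inverse[OF B E])
      show "k (inv_into F k y) = y" if "y \<in> k ` F" for y
        using that by (rule f_inv_into_f)
    qed
    then show "open F \<and> open (k ` F) \<and> homeomorphism F (k ` F) k (inv_into F k)"
      using chart_open_domain[OF A D] chart_open_domain[OF B E] chart_open_image[OF A D] chart_open_image[OF B E]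
      unfolding F map_prod_image_Times by (simp add: open_Times)
  qed
next
  show "\<forall>(F, k)\<in>prod_atlas A B. \<forall>(F', k')\<in>prod_atlas A B. smooth_on (k ` (F \<inter> F')) (k' \<circ> inv_into F k)"
  proof clarify
    fix F k F' k' assume "(F, k) \<in> prod_atlas A B" "(F', k') \<in> prod_atlas A B"
    then obtain D c E e D' c' E' e' where F: "F = D \<times> E" "k = map_prod c e" and D: "(D, c) \<in> A" and E: "(E, e) \<in> B"
      and F': "F' = D' \<times> E'" "k' = map_prod c' e'" and D': "(D', c') \<in> A" and E': "(E', e') \<in> B"
      by (metis prod_atlasE)
    have img: "k ` (F \<inter> F') = c ` (D \<inter> D') \<times> e ` (E \<inter> E')"
      unfolding F F' Times_Int_Times map_prod_image_Times ..
    have o: "open (c ` (D \<inter> D'))" "open (e ` (E \<inter> E'))"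
      by (intro chart_open_subset_image[OF A D] chart_open_subset_image[OF B E] open_Int
          chart_open_domain[OF A D] chart_open_domain[OF A D'] chart_open_domain[OF B E] chart_open_domain[OF B E']; simp)+
    have "smooth_on (c ` (D \<inter> D') \<times> e ` (E \<inter> E'))
        (\<lambda>z. ((c' \<circ> inv_into D c) (fst z), (e' \<circ> inv_into E e) (snd z)))"
      by (intro smooth_on_Pair open_Times o smooth_on_fst_comp smooth_on_snd_comp
          chart_transition[OF A D D'] chart_transition[OF B E E'])
    then show "smooth_on (k ` (F \<inter> F')) (k' \<circ> inv_into F k)"
      unfolding img
      by (rule smooth_on_cong[rotated 2]) (use o in \<open>auto simp: F F' prod_chart_inverse[OF D E] intro: open_Times\<close>)
  qed
qed

lemma smooth_fun_fst:
  assumes h: "smooth_fun A h"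
  shows "smooth_fun (prod_atlas A B) (\<lambda>x. h (fst x))"
proof (rule smooth_funI, erule prod_atlasE)
  fix F k D c E e
  assume F: "F = D \<times> E" "k = map_prod c e" and D: "(D, c) \<in> A" and E: "(E, e) \<in> B"
  have o: "open (c ` D)" "open (e ` E)"
    by (rule chart_open_image[OF A D] chart_open_image[OF B E])+
  show "smooth_on (k ` F) ((\<lambda>x. h (fst x)) \<circ> inv_into F k)"
    unfolding F map_prod_image_Times
    by (rule smooth_on_cong[OF open_Times[OF o] _ smooth_on_fst_comp[OF o smooth_funD[OF h D]]])
      (auto simp: prod_chart_inverse[OF D E])
qed

lemma smooth_fun_snd:
  assumes h: "smooth_fun B h"
  shows "smooth_fun (prod_atlas A B) (\<lambda>x. h (snd x))"
proof (rule smooth_funI, erule prod_atlasE)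
  fix F k D c E e
  assume F: "F = D \<times> E" "k = map_prod c e" and D: "(D, c) \<in> A" and E: "(E, e) \<in> B"
  have o: "open (c ` D)" "open (e ` E)"
    by (rule chart_open_image[OF A D] chart_open_image[OF B E])+
  show "smooth_on (k ` F) ((\<lambda>x. h (snd x)) \<circ> inv_into F k)"
    unfolding F map_prod_image_Times
    by (rule smooth_on_cong[OF open_Times[OF o] _ smooth_on_snd_comp[OF o smooth_funD[OF h E]]])
      (auto simp: prod_chart_inverse[OF D E])
qed

lemma smooth_fun_slice_fst:
  assumes h: "smooth_fun (prod_atlas A B) h"
  shows "smooth_fun A (\<lambda>p. h (p, q))"
proof (rule smooth_funI)
  fix D c assume D: "(D, c) \<in> A"
  obtain E e where E: "(E, e) \<in> B" "q \<in> E" by (rule manifold_chart_at[OF B])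
  have o: "open (c ` D)" by (rule chart_open_image[OF A D])
  have "smooth_on (c ` D) (\<lambda>y. (h \<circ> inv_into (D \<times> E) (map_prod c e)) (y, e q))"
    by (rule smooth_on_compose[OF o _ smooth_funD[OF h prod_atlasI[OF D E(1)]]])
      (use E o in \<open>auto simp: map_prod_image_Times intro: smooth_on_Pair smooth_on_id smooth_on_const\<close>)
  then show "smooth_on (c ` D) ((\<lambda>p. h (p, q)) \<circ> inv_into D c)"
    by (rule smooth_on_cong[OF o, rotated])
      (use E in \<open>auto simp: prod_chart_inverse[OF D E(1)] chart_inverse[OF B E]\<close>)
qed

lemma smooth_fun_slice_snd:
  assumes h: "smooth_fun (prod_atlas A B) h"
  shows "smooth_fun B (\<lambda>q. h (p, q))"
proof (rule smooth_funI)
  fix E e assume E: "(E, e) \<in> B"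
  obtain D c where D: "(D, c) \<in> A" "p \<in> D" by (rule manifold_chart_at[OF A])
  have o: "open (e ` E)" by (rule chart_open_image[OF B E])
  have "smooth_on (e ` E) (\<lambda>y. (h \<circ> inv_into (D \<times> E) (map_prod c e)) (c p, y))"
    by (rule smooth_on_compose[OF o _ smooth_funD[OF h prod_atlasI[OF D(1) E]]])
      (use D o in \<open>auto simp: map_prod_image_Times intro: smooth_on_Pair smooth_on_id smooth_on_const\<close>)
  then show "smooth_on (e ` E) ((\<lambda>q. h (p, q)) \<circ> inv_into E e)"
    by (rule smooth_on_cong[OF o, rotated])
      (use D in \<open>auto simp: prod_chart_inverse[OF D(1) E] chart_inverse[OF A D]\<close>)
qed

end

section \<open>Pushforwards, product fields and their brackets\<close>

lemma pushforward_tangent: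
  assumes B: "manifold B" and F: "\<And>h. smooth_fun B h \<Longrightarrow> smooth_fun A (\<lambda>x. h (F x))"
    and v: "v \<in> tangent_space A p"
  shows "pushforward B F v \<in> tangent_space B (F p)"
  unfolding tangent_space_def pushforward_def
  using tangent_add[OF v F F] tangent_mult[OF v F F] tangent_cmult[OF v F]
  by (simp add: comp_def smooth_fun_add[OF B] smooth_fun_mult[OF B] smooth_fun_const)

lemma pushforward_lincomb:
  "pushforward B F (a *\<^sub>R v + b *\<^sub>R w) = a *\<^sub>R pushforward B F v + b *\<^sub>R pushforward B F w"
  by (auto simp: pushforward_def fun_eq_iff)

definition prod_field ::
    "('a, 'd::euclidean_space) atlas \<Rightarrow> ('b, 'e::euclidean_space) atlas
      \<Rightarrow> 'a vfield \<Rightarrow> 'b vfield \<Rightarrow> ('a \<times> 'b) vfield"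
  where "prod_field A B X Y = (\<lambda>x. prod_vec A B x (X (fst x)) (Y (snd x)))"

lemma vertical_eq: "vertical A B U = prod_field A B 0 U"
  by (auto simp: vertical_def prod_field_def fun_eq_iff)

lemma prod_vec_apply:
  "smooth_fun (prod_atlas A B) h \<Longrightarrow>
    prod_vec A B x v w h = v (\<lambda>p. h (p, snd x)) + w (\<lambda>q. h (fst x, q))"
  by (simp add: prod_vec_def pushforward_def comp_def)

lemma prod_field_apply:
  "smooth_fun (prod_atlas A B) h \<Longrightarrow>
    prod_field A B X Y (p, q) h = X p (\<lambda>p. h (p, q)) + Y q (\<lambda>q. h (p, q))"
  by (simp add: prod_field_def prod_vec_apply)

lemma zero_vfields: "0 \<in> vfields A"
  by (simp add: vfields_def tangent_zero smooth_fun_const)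

text \<open>Each composition of two derivations violates the Leibniz rule by X h * Y k + X k * Y h;
  this is symmetric in X and Y and cancels in the commutator.\<close>

lemma bracket_vfields:
  assumes A: "manifold A" and X: "X \<in> vfields A" and Y: "Y \<in> vfields A"
  shows "bracket X Y \<in> vfields A"
  unfolding vfields_def
proof (intro CollectI conjI allI impI)
  fix p
  note X' = vfieldsD[OF X] and Y' = vfieldsD[OF Y]
  show "bracket X Y p \<in> tangent_space A p"
    unfolding tangent_space_def
  proof (intro CollectI conjI allI impI)
    fix h k assume h: "smooth_fun A h" and k: "smooth_fun A k"
    show "bracket X Y p (\<lambda>x. h x + k x) = bracket X Y p h + bracket X Y p k"
      by (simp add: bracket_def vderiv_def tangent_add[OF X'(1)] tangent_add[OF Y'(1)] X' Y' h k)
    have "smooth_fun A (\<lambda>x. h x * X x k)" "smooth_fun A (\<lambda>x. k x * X x h)"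
      "smooth_fun A (\<lambda>x. h x * Y x k)" "smooth_fun A (\<lambda>x. k x * Y x h)"
      by (intro smooth_fun_mult A h k X' Y')+
    then show "bracket X Y p (\<lambda>x. h x * k x) = h p * bracket X Y p k + k p * bracket X Y p h"
      by (simp add: bracket_def vderiv_def tangent_mult[OF X'(1)] tangent_mult[OF Y'(1)]
          tangent_add[OF X'(1)] tangent_add[OF Y'(1)] X' Y' h k algebra_simps)
  next
    fix a h assume h: "smooth_fun A h"
    show "bracket X Y p (\<lambda>x. a * h x) = a * bracket X Y p h"
      by (simp add: bracket_def vderiv_def tangent_cmult[OF X'(1)] tangent_cmult[OF Y'(1)] X' Y' h right_diff_distrib)
  next
    \<comment> \<open>On a non-smooth \<open>h\<close> both fields give the constant function 0,
      which every tangent vector sends to 0.\<close>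
    fix h assume h: "\<not> smooth_fun A h"
    show "bracket X Y p h = 0"
      by (simp add: bracket_def vderiv_def tangent_nonsmooth[OF X'(1) h] tangent_nonsmooth[OF Y'(1) h]
          tangent_const[OF X'(1)] tangent_const[OF Y'(1)])
  qed
next
  fix h assume "smooth_fun A h"
  then show "smooth_fun A (\<lambda>p. bracket X Y p h)"
    unfolding bracket_def vderiv_def by (intro smooth_fun_minus A vfieldsD[OF X] vfieldsD[OF Y])
qed

lemma bracket_zero_left:
  assumes "X \<in> vfields A"
  shows "bracket 0 X = 0"
  using tangent_const[OF vfieldsD(1)[OF assms], of _ 0] by (simp add: bracket_def vderiv_def fun_eq_iff)

lemma bracket_antisym: "bracket Y X p = - bracket X Y p"
  by (auto simp: bracket_def fun_eq_iff)

context
  fixes A :: "('a::{t2_space, second_countable_topology}, 'd::euclidean_space) atlas"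
    and B :: "('b::{t2_space, second_countable_topology}, 'e::euclidean_space) atlas"
  assumes A: "manifold A" and B: "manifold B"
begin

lemma pushforward_fst_tangent: "v \<in> tangent_space (prod_atlas A B) x \<Longrightarrow> pushforward A fst v \<in> tangent_space A (fst x)"
  by (rule pushforward_tangent[OF A]) (auto intro: smooth_fun_fst[OF A B])

lemma pushforward_snd_tangent: "v \<in> tangent_space (prod_atlas A B) x \<Longrightarrow> pushforward B snd v \<in> tangent_space B (snd x)"
  by (rule pushforward_tangent[OF B]) (auto intro: smooth_fun_snd[OF A B])

lemma prod_vec_tangent:
  assumes "v \<in> tangent_space A (fst x)" "w \<in> tangent_space B (snd x)"
  shows "prod_vec A B x v w \<in> tangent_space (prod_atlas A B) x"
  using pushforward_tangent[of "prod_atlas A B" A "\<lambda>p. (p, snd x)", OF manifold_prod[OF A B] smooth_fun_slice_fst[OF A B] assms(1)]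
    pushforward_tangent[of "prod_atlas A B" B "\<lambda>q. (fst x, q)", OF manifold_prod[OF A B] smooth_fun_slice_snd[OF A B] assms(2)]
  unfolding prod_vec_def by (simp add: tangent_plus)

lemma pushforward_prod_vec:
  assumes v: "v \<in> tangent_space A (fst x)" and w: "w \<in> tangent_space B (snd x)"
  shows "pushforward A fst (prod_vec A B x v w) = v" "pushforward B snd (prod_vec A B x v w) = w"
  using tangent_nonsmooth[OF v] tangent_nonsmooth[OF w]
  by (auto simp: pushforward_def fun_eq_iff prod_vec_apply smooth_fun_fst[OF A B] smooth_fun_snd[OF A B]
      comp_def tangent_const[OF v] tangent_const[OF w])

text \<open>For a product chart with a product cut-off, each test function of
  \<open>tangent_hadamard\<close> is a function of \<open>p\<close> times a function of
  \<open>q\<close>. By the Leibniz rule \<open>v\<close> kills such products, hence all components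
  of \<open>v\<close> vanish.\<close>

lemma prod_tangent_eq_0:
  assumes v: "v \<in> tangent_space (prod_atlas A B) x"
    and v1: "\<And>h. smooth_fun A h \<Longrightarrow> v (\<lambda>x. h (fst x)) = 0"
    and v2: "\<And>h. smooth_fun B h \<Longrightarrow> v (\<lambda>x. h (snd x)) = 0"
  shows "v = 0"
proof -
  let ?P = "prod_atlas A B"
  obtain p q where x: "x = (p, q)" by fastforce
  obtain D c where D: "(D, c) \<in> A" "p \<in> D" by (rule manifold_chart_at[OF A])
  obtain E e where E: "(E, e) \<in> B" "q \<in> E" by (rule manifold_chart_at[OF B])
  obtain S1 K1 \<rho>1 where "chart_bump A D c S1 K1 \<rho>1" and p: "c p \<in> S1" "\<rho>1 (c p) > 0"
    by (rule chart_bump_at[OF A D])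
  then interpret b1: chart_bump A D c S1 K1 \<rho>1 by simp
  obtain S2 K2 \<rho>2 where "chart_bump B E e S2 K2 \<rho>2" and q: "e q \<in> S2" "\<rho>2 (e q) > 0"
    by (rule chart_bump_at[OF B E])
  then interpret b2: chart_bump B E e S2 K2 \<rho>2 by simp
  let ?\<rho> = "\<lambda>z. \<rho>1 (fst z) * \<rho>2 (snd z)"
  interpret b: chart_bump ?P "D \<times> E" "map_prod c e" "S1 \<times> S2" "K1 \<times> K2" ?\<rho>
  proof
    have "smooth_on (UNIV \<times> UNIV) ?\<rho>"
      by (intro smooth_on_mult open_Times open_UNIV smooth_on_fst_comp smooth_on_snd_comp b1.smooth_bump b2.smooth_bump)
    then show "smooth_on UNIV ?\<rho>" by simp
    show "?\<rho> z = 0" if "z \<notin> K1 \<times> K2" for z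
      using that b1.bump_0[of "fst z"] b2.bump_0[of "snd z"] by (auto simp: mem_Times_iff)
  qed (use b1.S_sub b2.S_sub b1.K_sub b2.K_sub in \<open>auto intro!: manifold_prod[OF A B] prod_atlasI D E open_Times convex_Times
      b1.open_S b2.open_S b1.convex_S b2.convex_S compact_Times b1.compact_K b2.compact_K
      simp: map_prod_image_Times\<close>)
  have 0: "v (\<lambda>x. h (fst x) * k (snd x)) = 0" if "smooth_fun A h" "smooth_fun B k" for h k
    using tangent_mult[OF v smooth_fun_fst[OF A B that(1)] smooth_fun_snd[OF A B that(2)]] that v1 v2 by simp
  have "v (b.chart_ext (\<lambda>z. ?\<rho> z * ((z - map_prod c e x) \<bullet> b))) = 0" if "b \<in> Basis" for b
    using that unfolding Basis_prod_def
  proof (elim UnE imageE)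
    fix i :: 'd assume b: "b = (i, 0)"
    \<comment> \<open>A coordinate of the first factor: the second factor contributes only its
      cut-off, written with a factor 1 to match \<open>smooth_chart_ext_bump\<close>.\<close>
    have "b.chart_ext (\<lambda>z. ?\<rho> z * ((z - map_prod c e x) \<bullet> b)) =
        (\<lambda>x. b1.chart_ext (\<lambda>y. \<rho>1 y * ((y - c p) \<bullet> i)) (fst x) * b2.chart_ext (\<lambda>y. \<rho>2 y * 1) (snd x))"
      by (auto simp: b.chart_ext_def b1.chart_ext_def b2.chart_ext_def fun_eq_iff b x inner_prod_def)
    then show ?thesis
      by (simp only:) (intro 0 b1.smooth_chart_ext_bump b2.smooth_chart_ext_bump smooth_on_const;
        unfold inner_diff_left; intro smooth_on_minus smooth_on_inner_const smooth_on_id smooth_on_const b1.open_S)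
  next
    fix j :: 'e assume b: "b = (0, j)"
    have "b.chart_ext (\<lambda>z. ?\<rho> z * ((z - map_prod c e x) \<bullet> b)) =
        (\<lambda>x. b1.chart_ext (\<lambda>y. \<rho>1 y * 1) (fst x) * b2.chart_ext (\<lambda>y. \<rho>2 y * ((y - e q) \<bullet> j)) (snd x))"
      by (auto simp: b.chart_ext_def b1.chart_ext_def b2.chart_ext_def fun_eq_iff b x inner_prod_def)
    then show ?thesis
      by (simp only:) (intro 0 b1.smooth_chart_ext_bump b2.smooth_chart_ext_bump smooth_on_const;
        unfold inner_diff_left; intro smooth_on_minus smooth_on_inner_const smooth_on_id smooth_on_const b2.open_S)
  qed
  then have s: "(\<Sum>b\<in>Basis. v (b.chart_ext (\<lambda>z. ?\<rho> z * ((z - map_prod c e x) \<bullet> b))) *\<^sub>R b) = 0"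
    by simp
  have "v h = 0" if h: "smooth_fun ?P h" for h
  proof -
    have "linear (frechet_derivative (h \<circ> inv_into (D \<times> E) (map_prod c e)) (at (map_prod c e x)))"
      by (rule linear_frechet_derivative[OF smooth_on_differentiable[OF smooth_funD[OF h b.chart]]])
        (use D E in \<open>auto simp: x\<close>)
    then have "?\<rho> (map_prod c e x) * v h = 0"
      using b.tangent_hadamard[OF _ _ _ v h, unfolded s] D E p q by (simp add: x linear_0)
    then show ?thesis using p q by (simp add: x)
  qed
  then show ?thesis
    by (intro tangent_eqI[OF v tangent_zero]) simp
qed

lemma prod_tangent_eqI:
  assumes v: "v \<in> tangent_space (prod_atlas A B) x" and w: "w \<in> tangent_space (prod_atlas A B) x"
    and 1: "pushforward A fst v = pushforward A fst w" and 2: "pushforward B snd v = pushforward B snd w"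
  shows "v = w"
proof -
  have "v - w = 0"
  proof (rule prod_tangent_eq_0[OF tangent_diff[OF v w]])
    show "(v - w) (\<lambda>x. h (fst x)) = 0" if "smooth_fun A h" for h
      using fun_cong[OF 1, of h] that by (simp add: pushforward_def comp_def)
    show "(v - w) (\<lambda>x. h (snd x)) = 0" if "smooth_fun B h" for h
      using fun_cong[OF 2, of h] that by (simp add: pushforward_def comp_def)
  qed
  then show ?thesis by simp
qed

text \<open>Differentiating the slices of \<open>h\<close> by \<open>X\<close> must be smooth in
  both variables jointly, while membership in \<open>vfields\<close> concerns one slice at a time.
  The smooth local components of both fields express the result through the joint derivative of
  \<open>h\<close> in a product chart.\<close>

lemma prod_field_vfields:
  assumes X: "X \<in> vfields A" and Y: "Y \<in> vfields B"
  shows "prod_field A B X Y \<in> vfields (prod_atlas A B)"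
  unfolding vfields_def
proof (intro CollectI conjI allI impI)
  show "prod_field A B X Y x \<in> tangent_space (prod_atlas A B) x" for x
    unfolding prod_field_def by (intro prod_vec_tangent vfieldsD(1)[OF X] vfieldsD(1)[OF Y])
  fix h assume h: "smooth_fun (prod_atlas A B) h"
  show "smooth_fun (prod_atlas A B) (\<lambda>x. prod_field A B X Y x h)"
  proof (rule smooth_fun_locally[OF manifold_prod[OF A B]])
    fix x :: "'a \<times> 'b"
    obtain p q where x: "x = (p, q)" by fastforce
    obtain D c where D: "(D, c) \<in> A" "p \<in> D" by (rule manifold_chart_at[OF A])
    obtain E e where E: "(E, e) \<in> B" "q \<in> E" by (rule manifold_chart_at[OF B])
    obtain W1 a1 where W1: "open W1" "p \<in> W1" "W1 \<subseteq> D" "smooth_on (c ` W1) a1"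
      and a1: "\<forall>x\<in>W1. X x = coord_vec A D c x (a1 (c x))"
      by (rule vfield_local[OF A D X])
    obtain W2 a2 where W2: "open W2" "q \<in> W2" "W2 \<subseteq> E" "smooth_on (e ` W2) a2"
      and a2: "\<forall>x\<in>W2. Y x = coord_vec B E e x (a2 (e x))"
      by (rule vfield_local[OF B E Y])
    let ?k = "map_prod c e" and ?F = "D \<times> E"
    let ?H = "h \<circ> inv_into ?F ?k"
    have PF: "(?F, ?k) \<in> prod_atlas A B" by (rule prod_atlasI[OF D(1) E(1)])
    have H: "smooth_on (?k ` ?F) ?H" by (rule smooth_funD[OF h PF])
    have o: "open (c ` W1)" "open (e ` W2)"
      by (rule chart_open_subset_image[OF A D(1) W1(1,3)] chart_open_subset_image[OF B E(1) W2(1,3)])+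
    have sub: "c ` W1 \<times> e ` W2 \<subseteq> ?k ` ?F"
      using W1(3) W2(3) by (auto simp: map_prod_image_Times)
    have eq: "prod_field A B X Y (r, s) h = frechet_derivative ?H (at (c r, e s)) (a1 (c r), a2 (e s))"
      if r: "r \<in> W1" and s: "s \<in> W2" for r s
    proof -
      have d: "(?H has_derivative frechet_derivative ?H (at (c r, e s))) (at (c r, e s))"
        using smooth_on_differentiable[OF H, of "(c r, e s)"] subsetD[OF sub, of "(c r, e s)"] r s
        by (simp add: frechet_derivative_works)
      \<comment> \<open>Chain rule along the slice embedding: the derivative of a slice is the joint
        derivative in a direction (u, 0).\<close>
      have "((\<lambda>y. ?H (y, e s)) has_derivative (\<lambda>u. frechet_derivative ?H (at (c r, e s)) (u, 0))) (at (c r))"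
        by (rule has_derivative_compose[of "\<lambda>y. (y, e s)" "\<lambda>u. (u, 0)" "c r" UNIV ?H, OF _ d]) (auto intro!: derivative_eq_intros)
      then have "((\<lambda>p. h (p, s)) \<circ> inv_into D c has_derivative (\<lambda>u. frechet_derivative ?H (at (c r, e s)) (u, 0))) (at (c r))"
        by (rule has_derivative_transform_within_open[OF _ chart_open_image[OF A D(1)]])
          (use r s W1(3) W2(3) in \<open>auto simp: prod_chart_inverse[OF A B D(1) E(1)] chart_inverse[OF A D(1)] chart_inverse[OF B E(1)]\<close>)
      from frechet_derivative_at[OF this]
      have 1: "X r (\<lambda>p. h (p, s)) = frechet_derivative ?H (at (c r, e s)) (a1 (c r), 0)"
        by (metis a1 r coord_vec_def smooth_fun_slice_fst[OF A B h])
      have "((\<lambda>y. ?H (c r, y)) has_derivative (\<lambda>u. frechet_derivative ?H (at (c r, e s)) (0, u))) (at (e s))"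
        by (rule has_derivative_compose[of "\<lambda>y. (c r, y)" "\<lambda>u. (0, u)" "e s" UNIV ?H, OF _ d]) (auto intro!: derivative_eq_intros)
      then have "((\<lambda>q. h (r, q)) \<circ> inv_into E e has_derivative (\<lambda>u. frechet_derivative ?H (at (c r, e s)) (0, u))) (at (e s))"
        by (rule has_derivative_transform_within_open[OF _ chart_open_image[OF B E(1)]])
          (use r s W1(3) W2(3) in \<open>auto simp: prod_chart_inverse[OF A B D(1) E(1)] chart_inverse[OF A D(1)] chart_inverse[OF B E(1)]\<close>)
      from frechet_derivative_at[OF this]
      have 2: "Y s (\<lambda>q. h (r, q)) = frechet_derivative ?H (at (c r, e s)) (0, a2 (e s))"
        by (metis a2 s coord_vec_def smooth_fun_slice_snd[OF A B h])
      show ?thesis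
        unfolding prod_field_apply[OF h] 1 2
        by (subst linear_add[OF has_derivative_linear[OF d], symmetric]) simp
    qed
    have "smooth_on (c ` W1 \<times> e ` W2) (\<lambda>z. frechet_derivative ?H (at z) (a1 (fst z), a2 (snd z)))"
      by (intro smooth_on_frechet_apply smooth_on_subset[OF H sub] smooth_on_Pair open_Times o
          smooth_on_fst_comp smooth_on_snd_comp W1(4) W2(4))
    then have "smooth_on (?k ` (W1 \<times> W2)) ((\<lambda>x. prod_field A B X Y x h) \<circ> inv_into ?F ?k)"
      unfolding map_prod_image_Times
      by (rule smooth_on_cong[OF open_Times[OF o], rotated])
        (use W1(3) W2(3) in \<open>auto simp: eq prod_chart_inverse[OF A B D(1) E(1)] chart_inverse[OF A D(1)] chart_inverse[OF B E(1)] subset_iff\<close>)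
    moreover have "open (W1 \<times> W2)" "x \<in> W1 \<times> W2" "W1 \<times> W2 \<subseteq> ?F"
      using W1 W2 by (auto simp: x intro: open_Times)
    ultimately show "\<exists>D c W. (D, c) \<in> prod_atlas A B \<and> open W \<and> x \<in> W \<and> W \<subseteq> D \<and>
        smooth_on (c ` W) ((\<lambda>x. prod_field A B X Y x h) \<circ> inv_into D c)"
      using PF by blast
  qed
qed

text \<open>
  Comparing pushforwards avoids the symmetry of mixed partial derivatives.
\<close>

lemma bracket_prod_field:
  assumes X: "X \<in> vfields A" "X' \<in> vfields A" and Y: "Y \<in> vfields B" "Y' \<in> vfields B"
  shows "bracket (prod_field A B X Y) (prod_field A B X' Y') = prod_field A B (bracket X X') (bracket Y Y')"
proof
  fix x :: "'a \<times> 'b"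
  obtain p q where x: "x = (p, q)" by fastforce
  note P = manifold_prod[OF A B]
  note F = prod_field_vfields[OF X(1) Y(1)] prod_field_vfields[OF X(2) Y(2)]
  note XX = bracket_vfields[OF A X] and YY = bracket_vfields[OF B Y]
  have fst: "prod_field A B X Y y (\<lambda>x. h (fst x)) = X (fst y) h"
    if "Y \<in> vfields B" "smooth_fun A h" for X Y h y
    using that tangent_const[OF vfieldsD(1)[OF that(1)]] by (cases y) (simp add: prod_field_apply smooth_fun_fst[OF A B])
  have snd: "prod_field A B X Y y (\<lambda>x. h (snd x)) = Y (snd y) h"
    if "X \<in> vfields A" "smooth_fun B h" for X Y h y
    using that tangent_const[OF vfieldsD(1)[OF that(1)]] by (cases y) (simp add: prod_field_apply smooth_fun_snd[OF A B])
  have "bracket (prod_field A B X Y) (prod_field A B X' Y') x - prod_field A B (bracket X X') (bracket Y Y') x = 0"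
  proof (rule prod_tangent_eq_0)
    show "bracket (prod_field A B X Y) (prod_field A B X' Y') x - prod_field A B (bracket X X') (bracket Y Y') x
        \<in> tangent_space (prod_atlas A B) x"
      by (intro tangent_diff vfieldsD(1)[OF bracket_vfields[OF P F]] vfieldsD(1)[OF prod_field_vfields[OF XX YY]])
    show "(bracket (prod_field A B X Y) (prod_field A B X' Y') x - prod_field A B (bracket X X') (bracket Y Y') x)
        (\<lambda>x. h (fst x)) = 0" if h: "smooth_fun A h" for h
      using fst[OF Y(1) vfieldsD(2)[OF X(2) h]] fst[OF Y(2) vfieldsD(2)[OF X(1) h]]
      by (simp add: fst[OF YY h] bracket_def[of "prod_field A B X Y"] vderiv_def fst[OF Y(1) h] fst[OF Y(2) h])
        (simp add: bracket_def vderiv_def)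
    show "(bracket (prod_field A B X Y) (prod_field A B X' Y') x - prod_field A B (bracket X X') (bracket Y Y') x)
        (\<lambda>x. h (snd x)) = 0" if h: "smooth_fun B h" for h
      using snd[OF X(1) vfieldsD(2)[OF Y(2) h]] snd[OF X(2) vfieldsD(2)[OF Y(1) h]]
      by (simp add: snd[OF XX h] bracket_def[of "prod_field A B X Y"] vderiv_def snd[OF X(1) h] snd[OF X(2) h])
        (simp add: bracket_def vderiv_def)
  qed
  then show "bracket (prod_field A B X Y) (prod_field A B X' Y') x = prod_field A B (bracket X X') (bracket Y Y') x"
    by simp
qed

end


section \<open>Metrics, contact structures and the Koszul formula\<close>

text \<open>The algebraic part of \<open>riemannian_metric\<close>, common ground for applying
  \<open>koszul\<close> both to the metric of the second factor and to the twisted metric.\<close>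

definition symmetric_form ::
    "('a, 'd::euclidean_space) atlas \<Rightarrow> ('a \<Rightarrow> 'a tangent \<Rightarrow> 'a tangent \<Rightarrow> real) \<Rightarrow> bool"
  where "symmetric_form A g \<longleftrightarrow>
    (\<forall>p. \<forall>u\<in>tangent_space A p. \<forall>v\<in>tangent_space A p. \<forall>w\<in>tangent_space A p. \<forall>a b.
        g p (a *\<^sub>R u + b *\<^sub>R v) w = a * g p u w + b * g p v w) \<and>
    (\<forall>p. \<forall>v\<in>tangent_space A p. \<forall>w\<in>tangent_space A p. g p v w = g p w v)"

lemma riemannian_symmetric_form: "riemannian_metric A g \<Longrightarrow> symmetric_form A g"
  by (simp add: riemannian_metric_def symmetric_form_def)

lemma
  assumes g: "symmetric_form A g"
    and u: "u \<in> tangent_space A p" and v: "v \<in> tangent_space A p" and w: "w \<in> tangent_space A p"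
  shows form_sym: "g p v w = g p w v"
    and form_add_left: "g p (u + v) w = g p u w + g p v w"
    and form_diff_left: "g p (u - v) w = g p u w - g p v w"
    and form_scaleR_left: "g p (a *\<^sub>R u) w = a * g p u w"
    and form_minus_left: "g p (- u) w = - g p u w"
    and form_zero_left: "g p 0 w = 0"
    and form_add_right: "g p w (u + v) = g p w u + g p w v"
    and form_scaleR_right: "g p w (a *\<^sub>R u) = a * g p w u"
    and form_minus_right: "g p w (- u) = - g p w u"
    and form_zero_right: "g p w 0 = 0"
proof -
  have lin: "g p (a *\<^sub>R u + b *\<^sub>R v) w = a * g p u w + b * g p v w" for a b
    using g u v w by (simp add: symmetric_form_def)
  have sym: "g p x w = g p w x" if "x \<in> tangent_space A p" for x
    using g w that by (simp add: symmetric_form_def)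
  have m: "- u \<in> tangent_space A p"
    using tangent_scaleR[OF u, of "- 1"] by simp
  show "g p v w = g p w v"
    by (rule sym[OF v])
  show add: "g p (u + v) w = g p u w + g p v w" using lin[of 1 1] by simp
  show "g p (u - v) w = g p u w - g p v w" using lin[of 1 "- 1"] by simp
  show scale: "g p (a *\<^sub>R u) w = a * g p u w" using lin[of a 0] by simp
  show minus: "g p (- u) w = - g p u w" using lin[of "- 1" 0] by simp
  show zero: "g p 0 w = 0" using lin[of 0 0] by simp
  show "g p w (u + v) = g p w u + g p w v"
    using add by (simp add: sym[symmetric] u v tangent_plus)
  show "g p w (a *\<^sub>R u) = a * g p w u"
    using scale by (simp add: sym[symmetric] u tangent_scaleR)
  show "g p w (- u) = - g p w u"
    using minus by (simp add: sym[symmetric] u m)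
  show "g p w 0 = 0"
    using zero by (simp add: sym[symmetric] tangent_zero)
qed

lemma metric_eq_0:
  assumes "riemannian_metric A g" "v \<in> tangent_space A p" "g p v v = 0"
  shows "v = 0"
  using assms unfolding riemannian_metric_def by (metis less_irrefl)

lemma metric_eqI:
  assumes g: "riemannian_metric A g" and v: "v \<in> tangent_space A p" and w: "w \<in> tangent_space A p"
    and eq: "\<And>z. z \<in> tangent_space A p \<Longrightarrow> g p v z = g p w z"
  shows "v = w"
proof -
  have "g p (v - w) (v - w) = 0"
    using eq[OF tangent_diff[OF v w]]
    by (simp add: form_diff_left[OF riemannian_symmetric_form[OF g] v w tangent_diff[OF v w]])
  then have "v - w = 0"
    by (rule metric_eq_0[OF g tangent_diff[OF v w]])
  then show ?thesis by simp
qed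

text \<open>\<open>gradient\<close> is a definite description: a candidate provides existence and
  positive definiteness provides uniqueness.\<close>

lemma gradient_eqI:
  assumes g: "riemannian_metric A g" and v: "v \<in> tangent_space A p"
    and eq: "\<And>w. w \<in> tangent_space A p \<Longrightarrow> g p v w = w f"
  shows "gradient A g f p = v"
  unfolding gradient_def
proof (rule the_equality)
  show "v \<in> tangent_space A p \<and> (\<forall>w\<in>tangent_space A p. g p v w = w f)"
    using v eq by simp
  show "u = v" if "u \<in> tangent_space A p \<and> (\<forall>w\<in>tangent_space A p. g p u w = w f)" for u
    using that eq by (intro metric_eqI[OF g _ v]) simp_all
qed

lemma smooth_fun_metric:
  "riemannian_metric A g \<Longrightarrow> X \<in> vfields A \<Longrightarrow> Y \<in> vfields A \<Longrightarrow> smooth_fun A (\<lambda>p. g p (X p) (Y p))"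
  by (simp add: riemannian_metric_def)

lemma smooth_fun_one_form: "one_form A \<omega> \<Longrightarrow> X \<in> vfields A \<Longrightarrow> smooth_fun A (\<lambda>p. \<omega> p (X p))"
  by (simp add: one_form_def)

lemma
  assumes \<omega>: "one_form A \<omega>" and v: "v \<in> tangent_space A p"
  shows one_form_scaleR: "\<omega> p (a *\<^sub>R v) = a * \<omega> p v"
    and one_form_zero: "\<omega> p 0 = 0"
proof -
  have lin: "\<omega> p (a *\<^sub>R v + b *\<^sub>R v) = a * \<omega> p v + b * \<omega> p v" for a b
    using assms by (simp add: one_form_def)
  show "\<omega> p (a *\<^sub>R v) = a * \<omega> p v" using lin[of a 0] by simp
  show "\<omega> p 0 = 0" using lin[of 0 0] by simp
qed

text \<open>Expand the three derivatives by metric compatibility and the three brackets by vanishing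
  torsion; everything cancels except two copies of the left-hand term.\<close>

lemma koszul:
  assumes g: "symmetric_form A g" and lc: "levi_civita A g nabla"
    and X: "X \<in> vfields A" and Y: "Y \<in> vfields A" and Z: "Z \<in> vfields A"
  shows "2 * g p (nabla X Y p) (Z p) =
    X p (\<lambda>q. g q (Y q) (Z q)) + Y p (\<lambda>q. g q (X q) (Z q)) - Z p (\<lambda>q. g q (X q) (Y q))
    + g p (bracket X Y p) (Z p) - g p (bracket X Z p) (Y p) - g p (bracket Y Z p) (X p)"
proof -
  have n: "nabla X Y \<in> vfields A" if "X \<in> vfields A" "Y \<in> vfields A" for X Y
    using lc that by (simp add: levi_civita_def)
  have nT: "nabla X Y p \<in> tangent_space A p" if "X \<in> vfields A" "Y \<in> vfields A" for X Y
    by (rule vfieldsD(1)[OF n[OF that]])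
  have tors: "bracket X Y p = nabla X Y p - nabla Y X p" if "X \<in> vfields A" "Y \<in> vfields A" for X Y
  proof -
    have "nabla X Y - nabla Y X = bracket X Y"
      using lc that by (simp add: levi_civita_def)
    then show ?thesis by (metis fun_diff_def)
  qed
  \<comment> \<open>Symmetry puts every \<open>nabla\<close> term into the first slot, where the
    bracket terms produce theirs, so that equal terms match syntactically.\<close>
  have comp: "X p (\<lambda>q. g q (Y q) (Z q)) = g p (nabla X Y p) (Z p) + g p (nabla X Z p) (Y p)"
    if "X \<in> vfields A" "Y \<in> vfields A" "Z \<in> vfields A" for X Y Z
  proof -
    have "vderiv X (\<lambda>p. g p (Y p) (Z p)) = (\<lambda>p. g p (nabla X Y p) (Z p) + g p (Y p) (nabla X Z p))"
      using lc that by (simp add: levi_civita_def)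
    from fun_cong[OF this, of p] show ?thesis
      using form_sym[OF g nT[OF that(1,3)] nT[OF that(1,3)] vfieldsD(1)[OF that(2)]] by (simp add: vderiv_def)
  qed
  show ?thesis
    by (simp add: tors comp X Y Z form_diff_left[OF g nT nT] vfieldsD(1))
qed

lemma levi_civita_vfields: "levi_civita A g nabla \<Longrightarrow> X \<in> vfields A \<Longrightarrow> Y \<in> vfields A \<Longrightarrow> nabla X Y \<in> vfields A"
  by (simp add: levi_civita_def)

section \<open>Pointwise identities of a contact metric structure\<close>

locale contact =
  fixes A :: "('a::{t2_space, second_countable_topology}, 'd::euclidean_space) atlas"
    and \<phi> \<xi> \<eta> g
  assumes contact: "contact_metric A \<phi> \<xi> \<eta> g"
begin

lemma manifold: "manifold A" and xi: "\<xi> \<in> vfields A" and eta: "one_form A \<eta>"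
  and metric: "riemannian_metric A g" and eta_xi: "\<eta> p (\<xi> p) = 1"
  and d_eta: "U \<in> vfields A \<Longrightarrow> V \<in> vfields A \<Longrightarrow> ext_deriv \<eta> U V p = g p (U p) (\<phi> p (V p))"
  using contact by (auto simp: contact_metric_def)

lemmas form = riemannian_symmetric_form[OF metric]
lemmas xi_tangent = vfieldsD(1)[OF xi]

lemma phi_tangent: "u \<in> tangent_space A p \<Longrightarrow> \<phi> p u \<in> tangent_space A p"
  and phi_lincomb: "u \<in> tangent_space A p \<Longrightarrow> v \<in> tangent_space A p \<Longrightarrow>
    \<phi> p (a *\<^sub>R u + b *\<^sub>R v) = a *\<^sub>R \<phi> p u + b *\<^sub>R \<phi> p v"
  using contact unfolding contact_metric_def tensor11_def by blast+

lemma phi_scaleR: "u \<in> tangent_space A p \<Longrightarrow> \<phi> p (a *\<^sub>R u) = a *\<^sub>R \<phi> p u"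
  using phi_lincomb[of u p u a 0] by simp

lemma phi_phi:
  assumes "u \<in> tangent_space A p"
  shows "\<phi> p (\<phi> p u) = - u + \<eta> p u *\<^sub>R \<xi> p"
  by (rule tangent_extend[OF manifold assms]) (use contact in \<open>auto simp: contact_metric_def\<close>)

lemma metric_phi_phi:
  assumes "u \<in> tangent_space A p" "v \<in> tangent_space A p"
  shows "g p (\<phi> p u) (\<phi> p v) = g p u v - \<eta> p u * \<eta> p v"
  by (rule tangent_extend[OF manifold assms(1)], rule tangent_extend[OF manifold assms(2)])
    (use contact in \<open>auto simp: contact_metric_def\<close>)

text \<open>The formula for \<phi>^2 gives \<phi>^2 \<xi> = 0, and applied to \<phi> \<xi> it gives
  \<phi> \<xi> = c \<xi> with c = \<eta>(\<phi> \<xi>). Then c^2 \<xi> = \<phi>^2 \<xi> = 0, and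
  \<eta>(\<xi>) = 1 forces c = 0.\<close>

lemma phi_xi: "\<phi> p (\<xi> p) = 0"
proof -
  let ?c = "\<eta> p (\<phi> p (\<xi> p))"
  have 0: "\<phi> p (\<phi> p (\<xi> p)) = 0"
    by (simp add: phi_phi xi_tangent eta_xi)
  have "\<phi> p 0 = 0"
    using phi_scaleR[OF xi_tangent, of p 0] by simp
  then have "\<phi> p (\<xi> p) = ?c *\<^sub>R \<xi> p"
    using phi_phi[OF phi_tangent[OF xi_tangent], of p] by (simp add: 0)
  then have "(?c * ?c) *\<^sub>R \<xi> p = 0"
    by (metis phi_scaleR xi_tangent scaleR_scaleR 0)
  then have "\<eta> p ((?c * ?c) *\<^sub>R \<xi> p) = 0"
    using one_form_zero[OF eta xi_tangent, of p] by (simp only:)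
  then have "?c = 0"
    using one_form_scaleR[OF eta xi_tangent, of p "?c * ?c"] by (simp add: eta_xi)
  with \<open>\<phi> p (\<xi> p) = ?c *\<^sub>R \<xi> p\<close> show ?thesis by simp
qed

text \<open>In the compatibility of g with \<phi>, the second argument \<xi> makes the left-hand
  side vanish.\<close>

lemma metric_xi:
  assumes u: "u \<in> tangent_space A p"
  shows "g p u (\<xi> p) = \<eta> p u"
  using metric_phi_phi[OF u xi_tangent] form_zero_right[OF form u u phi_tangent[OF u]]
  by (simp add: phi_xi eta_xi)

text \<open>Computing \<phi>^3 u as \<phi>(\<phi>^2 u) and as \<phi>^2(\<phi> u), the two results
  differ by \<eta>(\<phi> u) \<xi>.\<close>

lemma eta_phi:
  assumes u: "u \<in> tangent_space A p"
  shows "\<eta> p (\<phi> p u) = 0"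
proof -
  have "\<phi> p ((- 1) *\<^sub>R u + \<eta> p u *\<^sub>R \<xi> p) = - \<phi> p u + \<eta> p u *\<^sub>R \<phi> p (\<xi> p)"
    unfolding phi_lincomb[OF u xi_tangent] by simp
  then have "\<phi> p (\<phi> p (\<phi> p u)) = - \<phi> p u"
    by (simp add: phi_phi[OF u] phi_xi)
  then have "\<eta> p (\<phi> p u) *\<^sub>R \<xi> p = 0"
    using phi_phi[OF phi_tangent[OF u]] by simp
  then have "\<eta> p (\<eta> p (\<phi> p u) *\<^sub>R \<xi> p) = 0"
    by (simp only: one_form_zero[OF eta xi_tangent])
  then show ?thesis
    unfolding one_form_scaleR[OF eta xi_tangent] eta_xi by simp
qed

text \<open>Compatibility with \<phi> v in place of v; both terms in \<eta> drop out by
  \<open>eta_phi\<close>.\<close>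

lemma phi_skew:
  assumes u: "u \<in> tangent_space A p" and v: "v \<in> tangent_space A p"
  shows "g p u (\<phi> p v) = - g p (\<phi> p u) v"
proof -
  note pu = phi_tangent[OF u]
  have mv: "- v \<in> tangent_space A p" using tangent_scaleR[OF v, of "- 1"] by simp
  have "g p (\<phi> p u) (\<phi> p (\<phi> p v)) = - g p (\<phi> p u) v"
    unfolding phi_phi[OF v] form_add_right[OF form mv tangent_scaleR[OF xi_tangent] pu]
      form_scaleR_right[OF form xi_tangent xi_tangent pu] form_minus_right[OF form v v pu]
    by (simp add: metric_xi[OF pu] eta_phi[OF u])
  then show ?thesis
    using metric_phi_phi[OF u phi_tangent[OF v]] by (simp add: eta_phi[OF v])
qed

text \<open>In the Koszul formula tested with \<xi>, the derivative along \<xi> and the two brackets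
  with \<xi> form, up to sign, the Lie derivative of g along \<xi>, which vanishes;
  \<open>metric_xi\<close> turns the remaining terms into \<eta>.\<close>

lemma eta_levi_civita:
  assumes k: "killing A g \<xi>" and lc: "levi_civita A g nabla"
    and U: "U \<in> vfields A" and V: "V \<in> vfields A"
  shows "2 * \<eta> p (nabla U V p) =
    U p (\<lambda>q. \<eta> q (V q)) + V p (\<lambda>q. \<eta> q (U q)) + \<eta> p (bracket U V p)"
proof -
  note T = vfieldsD(1)[OF U] vfieldsD(1)[OF V]
  note br = vfieldsD(1)[OF bracket_vfields[OF manifold xi U]] vfieldsD(1)[OF bracket_vfields[OF manifold xi V]]
  have "g p (bracket U \<xi> p) (V p) = - g p (bracket \<xi> U p) (V p)"
    "g p (bracket V \<xi> p) (U p) = - g p (U p) (bracket \<xi> V p)"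
    unfolding bracket_antisym[of U \<xi>] bracket_antisym[of V \<xi>]
    using form_minus_left[OF form br(1,1) T(2)] form_minus_left[OF form br(2,2) T(1)]
      form_sym[OF form T(1) T(1) br(2)] by simp_all
  moreover have "\<xi> p (\<lambda>q. g q (U q) (V q)) - g p (bracket \<xi> U p) (V p) - g p (U p) (bracket \<xi> V p) = 0"
    using k U V by (simp add: killing_def)
  ultimately show ?thesis
    using koszul[OF form lc U V xi, of p]
    by (simp add: metric_xi vfieldsD(1)[OF levi_civita_vfields[OF lc U V]] T
        vfieldsD(1)[OF bracket_vfields[OF manifold U V]])
qed

end

section \<open>The connection of the twisted metric on vertical fields\<close>

locale twisted_product = contact A2 \<phi> \<xi> \<eta> g2
  for A2 :: "('b::{t2_space, second_countable_topology}, 'e::euclidean_space) atlas"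
    and \<phi> \<xi> \<eta> g2 +
  fixes A1 :: "('a::{t2_space, second_countable_topology}, 'd::euclidean_space) atlas"
    and g1 \<omega> \<alpha> f nabla2 nabla
  assumes manifold1: "manifold A1" and metric1: "riemannian_metric A1 g1" and omega: "one_form A1 \<omega>"
    and smooth_f: "smooth_fun A1 f" and f_pos: "f p > 0"
    and killing: "killing A2 g2 \<xi>"
    and lc2: "levi_civita A2 g2 nabla2"
    and lc: "levi_civita (prod_atlas A1 A2) (twisted_warped_metric A1 A2 \<alpha> f \<omega> \<eta> g1 g2) nabla"
begin

abbreviation "P \<equiv> prod_atlas A1 A2"
abbreviation "G \<equiv> twisted_warped_metric A1 A2 \<alpha> f \<omega> \<eta> g1 g2"
abbreviation "lift \<equiv> prod_field A1 A2"
abbreviation "fst_part \<equiv> pushforward A1 fst"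
abbreviation "snd_part \<equiv> pushforward A2 snd"

lemmas form1 = riemannian_symmetric_form[OF metric1]
lemmas fst_part_tangent = pushforward_fst_tangent[OF manifold1 manifold, of _ "(p, q)" for p q, simplified]
lemmas snd_part_tangent = pushforward_snd_tangent[OF manifold1 manifold, of _ "(p, q)" for p q, simplified]

text \<open>The first argument stays arbitrary because it will be the unknown covariant derivative,
  accessible only through its pushforwards.\<close>

lemma metric_prod_vec:
  assumes "z \<in> tangent_space A1 p" "w \<in> tangent_space A2 q"
  shows "G (p, q) x (prod_vec A1 A2 (p, q) z w) =
    g1 p (fst_part x) z + (f p)\<^sup>2 * (g2 q (snd_part x) w - \<eta> q (snd_part x) * \<eta> q w)
    + (\<alpha> * \<omega> p (fst_part x) + \<eta> q (snd_part x)) * (\<alpha> * \<omega> p z + \<eta> q w)"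
  using pushforward_prod_vec[OF manifold1 manifold, of z "(p, q)" w] assms
  by (simp add: twisted_warped_metric_def bar_eta_def)

lemma metric_lift:
  assumes "X \<in> vfields A1" "X' \<in> vfields A1" "Y \<in> vfields A2" "Y' \<in> vfields A2"
  shows "G (p, q) (lift X Y (p, q)) (lift X' Y' (p, q)) =
    g1 p (X p) (X' p) + (f p)\<^sup>2 * (g2 q (Y q) (Y' q) - \<eta> q (Y q) * \<eta> q (Y' q))
    + (\<alpha> * \<omega> p (X p) + \<eta> q (Y q)) * (\<alpha> * \<omega> p (X' p) + \<eta> q (Y' q))"
  using pushforward_prod_vec[OF manifold1 manifold, of "X p" "(p, q)" "Y q"] assms
  by (simp add: prod_field_def metric_prod_vec vfieldsD(1))

lemma symmetric_form_twisted: "symmetric_form P G"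
  unfolding symmetric_form_def
proof (intro conjI allI ballI)
  fix x :: "'a \<times> 'b" and u v w a b
  obtain p q where x: "x = (p, q)" by fastforce
  assume "u \<in> tangent_space P x" "v \<in> tangent_space P x" "w \<in> tangent_space P x"
  then have T: "fst_part u \<in> tangent_space A1 p" "fst_part v \<in> tangent_space A1 p" "fst_part w \<in> tangent_space A1 p"
    "snd_part u \<in> tangent_space A2 q" "snd_part v \<in> tangent_space A2 q" "snd_part w \<in> tangent_space A2 q"
    by (auto simp: x intro: fst_part_tangent snd_part_tangent)
  have lin: "g1 p (a *\<^sub>R fst_part u + b *\<^sub>R fst_part v) (fst_part w) = a * g1 p (fst_part u) (fst_part w) + b * g1 p (fst_part v) (fst_part w)"
    "g2 q (a *\<^sub>R snd_part u + b *\<^sub>R snd_part v) (snd_part w) = a * g2 q (snd_part u) (snd_part w) + b * g2 q (snd_part v) (snd_part w)"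
    "\<omega> p (a *\<^sub>R fst_part u + b *\<^sub>R fst_part v) = a * \<omega> p (fst_part u) + b * \<omega> p (fst_part v)"
    "\<eta> q (a *\<^sub>R snd_part u + b *\<^sub>R snd_part v) = a * \<eta> q (snd_part u) + b * \<eta> q (snd_part v)"
    using form1 form omega eta T by (auto simp: symmetric_form_def one_form_def)
  show "G x (a *\<^sub>R u + b *\<^sub>R v) w = a * G x u w + b * G x v w"
    by (simp add: x twisted_warped_metric_def bar_eta_def pushforward_lincomb lin algebra_simps)
next
  fix x :: "'a \<times> 'b" and v w
  obtain p q where x: "x = (p, q)" by fastforce
  assume "v \<in> tangent_space P x" "w \<in> tangent_space P x"
  then have T: "fst_part v \<in> tangent_space A1 p" "fst_part w \<in> tangent_space A1 p"
    "snd_part v \<in> tangent_space A2 q" "snd_part w \<in> tangent_space A2 q"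
    by (auto simp: x intro: fst_part_tangent snd_part_tangent)
  show "G x v w = G x w v"
    using form_sym[OF form1 T(1,1,2)] form_sym[OF form T(3,3,4)]
    by (simp add: x twisted_warped_metric_def bar_eta_def algebra_simps)
qed

text \<open>The coefficient 1 - f^2 of the \<eta> terms combines -f^2 from the scaled transversal
  part of the metric with 1 from the square of \<open>bar_eta\<close>.\<close>

lemma lift_derivative_metric:
  assumes U: "U \<in> vfields A2" and V: "V \<in> vfields A2" and W: "W \<in> vfields A2" and Z: "Z \<in> vfields A1"
  shows "lift 0 U (p, q) (\<lambda>x. G x (lift 0 V x) (lift Z W x)) =
    (f p)\<^sup>2 * U q (\<lambda>q. g2 q (V q) (W q)) + \<alpha> * \<omega> p (Z p) * U q (\<lambda>q. \<eta> q (V q))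
    + (1 - (f p)\<^sup>2) * (\<eta> q (V q) * U q (\<lambda>q. \<eta> q (W q)) + \<eta> q (W q) * U q (\<lambda>q. \<eta> q (V q)))"
proof -
  let ?v = "\<lambda>q. \<eta> q (V q)" and ?w = "\<lambda>q. \<eta> q (W q)" and ?m = "\<lambda>q. g2 q (V q) (W q)"
  let ?f = "\<lambda>p. f p * f p" and ?z = "\<lambda>p. \<alpha> * \<omega> p (Z p)"
  have s: "smooth_fun A2 ?v" "smooth_fun A2 ?w" "smooth_fun A2 ?m" "smooth_fun A1 ?f" "smooth_fun A1 ?z"
    by (intro smooth_fun_one_form[OF eta] smooth_fun_metric[OF metric] smooth_fun_mult[OF manifold1] smooth_fun_const
        smooth_fun_one_form[OF omega] smooth_f U V W Z)+
  have vw: "smooth_fun A2 (\<lambda>q. ?v q * ?w q)" by (intro smooth_fun_mult manifold s)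
  define h where "h x = ?f (fst x) * (?m (snd x) - ?v (snd x) * ?w (snd x)) + ?v (snd x) * (?z (fst x) + ?w (snd x))" for x
  have "smooth_fun P h"
    unfolding h_def
    by (intro smooth_fun_add smooth_fun_mult smooth_fun_minus manifold_prod manifold1 manifold
        smooth_fun_fst[OF manifold1 manifold s(4)] smooth_fun_fst[OF manifold1 manifold s(5)]
        smooth_fun_snd[OF manifold1 manifold s(1)] smooth_fun_snd[OF manifold1 manifold s(2)]
        smooth_fun_snd[OF manifold1 manifold s(3)])
  moreover have "(\<lambda>x. G x (lift 0 V x) (lift Z W x)) = h"
  proof
    show "G x (lift 0 V x) (lift Z W x) = h x" for x
      using metric_lift[OF zero_vfields Z V W, of "fst x" "snd x"]
        form_zero_left[OF form1 tangent_zero tangent_zero vfieldsD(1)[OF Z], of "fst x"]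
        one_form_zero[OF omega tangent_zero, of "fst x"]
      by (simp add: h_def power2_eq_square)
  qed
  ultimately have "lift 0 U (p, q) (\<lambda>x. G x (lift 0 V x) (lift Z W x)) = U q (\<lambda>q. h (p, q))"
    by (simp add: prod_field_apply)
  \<comment> \<open>Along the second factor f and \<omega>(Z) are constants; regrouping turns them
    into scalar factors that pass through the derivation.\<close>
  also have "(\<lambda>q. h (p, q)) = (\<lambda>q. (?f p * ?m q + ?z p * ?v q) + (1 - ?f p) * (?v q * ?w q))"
    by (simp add: h_def fun_eq_iff algebra_simps)
  also have "U q \<dots> = ?f p * U q ?m + ?z p * U q ?v + (1 - ?f p) * (?v q * U q ?w + ?w q * U q ?v)"
    by (subst tangent_add[OF vfieldsD(1)[OF U]] tangent_cmult[OF vfieldsD(1)[OF U]] tangent_mult[OF vfieldsD(1)[OF U]];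
      (intro smooth_fun_add smooth_fun_mult smooth_fun_const manifold s)?)+ simp
  finally show ?thesis unfolding power2_eq_square .
qed

text \<open>Here f itself gets differentiated: the term with \<open>Z p f\<close> is the source of
  the gradient in the result.\<close>

lemma lift_derivative_metric_vertical:
  assumes U: "U \<in> vfields A2" and V: "V \<in> vfields A2" and W: "W \<in> vfields A2" and Z: "Z \<in> vfields A1"
  shows "lift Z W (p, q) (\<lambda>x. G x (lift 0 U x) (lift 0 V x)) =
    2 * f p * Z p f * (g2 q (U q) (V q) - \<eta> q (U q) * \<eta> q (V q)) + (f p)\<^sup>2 * W q (\<lambda>q. g2 q (U q) (V q))
    + (1 - (f p)\<^sup>2) * (\<eta> q (U q) * W q (\<lambda>q. \<eta> q (V q)) + \<eta> q (V q) * W q (\<lambda>q. \<eta> q (U q)))"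
proof -
  let ?u = "\<lambda>q. \<eta> q (U q)" and ?v = "\<lambda>q. \<eta> q (V q)" and ?m = "\<lambda>q. g2 q (U q) (V q)"
  let ?f = "\<lambda>p. f p * f p"
  have s: "smooth_fun A2 ?u" "smooth_fun A2 ?v" "smooth_fun A2 ?m" "smooth_fun A1 ?f"
    by (intro smooth_fun_one_form[OF eta] smooth_fun_metric[OF metric] smooth_fun_mult[OF manifold1]
        smooth_f U V)+
  define h where "h x = ?f (fst x) * (?m (snd x) - ?u (snd x) * ?v (snd x)) + ?u (snd x) * ?v (snd x)" for x
  have "smooth_fun P h"
    unfolding h_def
    by (intro smooth_fun_add smooth_fun_mult smooth_fun_minus manifold_prod manifold1 manifold
        smooth_fun_fst[OF manifold1 manifold s(4)] smooth_fun_snd[OF manifold1 manifold s(1)]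
        smooth_fun_snd[OF manifold1 manifold s(2)] smooth_fun_snd[OF manifold1 manifold s(3)])
  moreover have "(\<lambda>x. G x (lift 0 U x) (lift 0 V x)) = h"
  proof
    show "G x (lift 0 U x) (lift 0 V x) = h x" for x
      using metric_lift[OF zero_vfields zero_vfields U V, of "fst x" "snd x"]
        form_zero_left[OF form1 tangent_zero tangent_zero tangent_zero, of "fst x"]
        one_form_zero[OF omega tangent_zero, of "fst x"]
      by (simp add: h_def power2_eq_square)
  qed
  ultimately have "lift Z W (p, q) (\<lambda>x. G x (lift 0 U x) (lift 0 V x)) = Z p (\<lambda>p. h (p, q)) + W q (\<lambda>q. h (p, q))"
    by (simp add: prod_field_apply)
  also have "(\<lambda>q. h (p, q)) = (\<lambda>q. ?f p * ?m q + (1 - ?f p) * (?u q * ?v q))"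
    by (simp add: h_def fun_eq_iff algebra_simps)
  also have "W q \<dots> = ?f p * W q ?m + (1 - ?f p) * (?u q * W q ?v + ?v q * W q ?u)"
    by (subst tangent_add[OF vfieldsD(1)[OF W]] tangent_cmult[OF vfieldsD(1)[OF W]] tangent_mult[OF vfieldsD(1)[OF W]];
      (intro smooth_fun_add smooth_fun_mult smooth_fun_const manifold s)?)+ simp
  also have "(\<lambda>p. h (p, q)) = (\<lambda>p. (?m q - ?u q * ?v q) * (f p * f p) + ?u q * ?v q)"
    by (simp add: h_def fun_eq_iff algebra_simps)
  also have "Z p \<dots> = (?m q - ?u q * ?v q) * (f p * Z p f + f p * Z p f)"
    by (subst tangent_add[OF vfieldsD(1)[OF Z]] tangent_cmult[OF vfieldsD(1)[OF Z]] tangent_mult[OF vfieldsD(1)[OF Z]]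
      tangent_const[OF vfieldsD(1)[OF Z]];
      (intro smooth_fun_mult smooth_fun_const manifold1 s smooth_f)?)+ simp
  finally show ?thesis
    unfolding power2_eq_square by (rule trans) algebra
qed

context
  fixes U V assumes U: "U \<in> vfields A2" and V: "V \<in> vfields A2"
begin

abbreviation "N \<equiv> nabla (lift 0 U) (lift 0 V)"
abbreviation "N1 x \<equiv> fst_part (N x)"
abbreviation "N2 x \<equiv> snd_part (N x)"

lemma N_tangent: "N x \<in> tangent_space P x"
  by (intro vfieldsD(1)[OF levi_civita_vfields[OF lc]] prod_field_vfields manifold1 manifold zero_vfields U V)

lemma N1_tangent: "N1 (p, q) \<in> tangent_space A1 p" and N2_tangent: "N2 (p, q) \<in> tangent_space A2 q"
  by (rule fst_part_tangent[OF N_tangent] snd_part_tangent[OF N_tangent])+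

lemma nabla2_tangent: "nabla2 U V q \<in> tangent_space A2 q"
  by (rule vfieldsD(1)[OF levi_civita_vfields[OF lc2 U V]])

text \<open>The Koszul formula of the twisted metric with all derivatives and brackets eliminated.
  What remains depends on the test fields only through their values, so single vectors
  \<open>z\<close> and \<open>w\<close> suffice.\<close>

lemma koszul_vertical:
  assumes z: "z \<in> tangent_space A1 p" and w: "w \<in> tangent_space A2 q"
  shows "g1 p (N1 (p, q)) z + (f p)\<^sup>2 * (g2 q (N2 (p, q)) w - \<eta> q (N2 (p, q)) * \<eta> q w)
      + (\<alpha> * \<omega> p (N1 (p, q)) + \<eta> q (N2 (p, q))) * (\<alpha> * \<omega> p z + \<eta> q w)
    = \<alpha> * \<omega> p z * \<eta> q (nabla2 U V q) - f p * z f * g2 q (\<phi> q (U q)) (\<phi> q (V q))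
      + (f p)\<^sup>2 * g2 q (nabla2 U V q) w
      + (1 - (f p)\<^sup>2) * (\<eta> q w * \<eta> q (nabla2 U V q) + \<eta> q (V q) * g2 q (U q) (\<phi> q w) + \<eta> q (U q) * g2 q (V q) (\<phi> q w))"
proof -
  obtain Z where Z: "Z \<in> vfields A1" "Z p = z"
    by (rule tangent_extend[OF manifold1 z])
  obtain W where W: "W \<in> vfields A2" "W q = w"
    by (rule tangent_extend[OF manifold w])
  have br: "bracket (lift 0 U) (lift 0 V) = lift 0 (bracket U V)"
    "bracket (lift 0 U) (lift Z W) = lift 0 (bracket U W)"
    "bracket (lift 0 V) (lift Z W) = lift 0 (bracket V W)"
    using bracket_prod_field[OF manifold1 manifold zero_vfields zero_vfields U V]
      bracket_prod_field[OF manifold1 manifold zero_vfields Z(1) U W(1)]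
      bracket_prod_field[OF manifold1 manifold zero_vfields Z(1) V W(1)]
    by (simp_all only: bracket_zero_left[OF zero_vfields] bracket_zero_left[OF Z(1)])
  note b = bracket_vfields[OF manifold U V] bracket_vfields[OF manifold U W(1)] bracket_vfields[OF manifold V W(1)]
  have zero: "g1 p 0 z = 0" "g1 p 0 0 = 0" "\<omega> p 0 = 0"
    using form_zero_left[OF form1 tangent_zero tangent_zero z] form_zero_left[OF form1 tangent_zero tangent_zero tangent_zero]
      one_form_zero[OF omega tangent_zero] by simp_all
  have GN: "G (p, q) (N (p, q)) (lift Z W (p, q)) =
      g1 p (N1 (p, q)) z + (f p)\<^sup>2 * (g2 q (N2 (p, q)) w - \<eta> q (N2 (p, q)) * \<eta> q w)
      + (\<alpha> * \<omega> p (N1 (p, q)) + \<eta> q (N2 (p, q))) * (\<alpha> * \<omega> p z + \<eta> q w)"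
    using metric_prod_vec[OF z w] by (simp add: prod_field_def Z(2) W(2))
  have K: "2 * G (p, q) (N (p, q)) (lift Z W (p, q)) =
      lift 0 U (p, q) (\<lambda>x. G x (lift 0 V x) (lift Z W x)) + lift 0 V (p, q) (\<lambda>x. G x (lift 0 U x) (lift Z W x))
      - lift Z W (p, q) (\<lambda>x. G x (lift 0 U x) (lift 0 V x))
      + G (p, q) (lift 0 (bracket U V) (p, q)) (lift Z W (p, q)) - G (p, q) (lift 0 (bracket U W) (p, q)) (lift 0 V (p, q))
      - G (p, q) (lift 0 (bracket V W) (p, q)) (lift 0 U (p, q))"
    using koszul[OF symmetric_form_twisted lc, of "lift 0 U" "lift 0 V" "lift Z W" "(p, q)"]
    by (simp only: br prod_field_vfields[OF manifold1 manifold] zero_vfields U V W Z simp_thms)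
  have K2: "2 * g2 q (nabla2 U V q) w =
      U q (\<lambda>q. g2 q (V q) (W q)) + V q (\<lambda>q. g2 q (U q) (W q)) - W q (\<lambda>q. g2 q (U q) (V q))
      + g2 q (bracket U V q) w - g2 q (bracket U W q) (V q) - g2 q (bracket V W q) (U q)"
    using koszul[OF form lc2 U V W(1), of q] by (simp only: W(2))
  have E: "2 * \<eta> q (nabla2 U V q) =
      U q (\<lambda>q. \<eta> q (V q)) + V q (\<lambda>q. \<eta> q (U q)) + \<eta> q (bracket U V q)"
    by (rule eta_levi_civita[OF killing lc2 U V])
  have D: "2 * g2 q (U q) (\<phi> q w) = U q (\<lambda>q. \<eta> q (W q)) - W q (\<lambda>q. \<eta> q (U q)) - \<eta> q (bracket U W q)"
    "2 * g2 q (V q) (\<phi> q w) = V q (\<lambda>q. \<eta> q (W q)) - W q (\<lambda>q. \<eta> q (V q)) - \<eta> q (bracket V W q)"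
    using d_eta[OF U W(1), of q] d_eta[OF V W(1), of q] by (simp_all add: ext_deriv_def W(2))
  note M = lift_derivative_metric[OF U V W(1) Z(1), of p q] lift_derivative_metric[OF V U W(1) Z(1), of p q]
    lift_derivative_metric_vertical[OF U V W(1) Z(1), of p q]
    metric_lift[OF zero_vfields Z(1) b(1) W(1), of p q] metric_lift[OF zero_vfields zero_vfields b(2) V, of p q]
    metric_lift[OF zero_vfields zero_vfields b(3) U, of p q]
  have B: "g2 q (\<phi> q (U q)) (\<phi> q (V q)) = g2 q (U q) (V q) - \<eta> q (U q) * \<eta> q (V q)"
    by (rule metric_phi_phi[OF vfieldsD(1)[OF U] vfieldsD(1)[OF V]])
  \<comment> \<open>Sorted by coefficients: f^2 collects \<open>K2\<close>, \<alpha> \<omega>(z)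
    collects \<open>E\<close>, and 1 - f^2 collects \<open>E\<close> times \<eta>(w) and the two
    identities \<open>D\<close> times \<eta>(V) and \<eta>(U).\<close>
  show ?thesis
    unfolding GN[symmetric] B
    using K K2 E D unfolding M zero_fun_apply zero Z(2) W(2) by algebra
qed

text \<open>The test vector is (0, \<xi>): by \<open>metric_xi\<close> the part with f^2 cancels on
  the left, by \<open>phi_xi\<close> the d\<eta> terms vanish, and on the right f^2 and 1 - f^2 add
  up to 1.\<close>

lemma eta_bar_N: "\<alpha> * \<omega> p (N1 (p, q)) + \<eta> q (N2 (p, q)) = \<eta> q (nabla2 U V q)"
proof -
  have "g1 p (N1 (p, q)) 0 = 0" "g2 q (U q) 0 = 0" "g2 q (V q) 0 = 0" "\<omega> p 0 = 0"
    using form_zero_right[OF form1 tangent_zero tangent_zero N1_tangent] form_zero_right[OF form tangent_zero tangent_zero]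
      one_form_zero[OF omega tangent_zero] vfieldsD(1)[OF U] vfieldsD(1)[OF V] by simp_all
  then show ?thesis
    using koszul_vertical[OF tangent_zero[of A1 p] xi_tangent[of q]]
    by (simp add: metric_xi N2_tangent nabla2_tangent eta_xi phi_xi algebra_simps)
qed

text \<open>The test vector is (z, 0): by \<open>eta_bar_N\<close> both sides contain the same
  multiple of \<alpha> \<omega>(z), which cancels.\<close>

lemma N1_metric:
  assumes z: "z \<in> tangent_space A1 p"
  shows "g1 p (N1 (p, q)) z = - (f p * g2 q (\<phi> q (U q)) (\<phi> q (V q))) * z f"
proof -
  have "\<phi> q 0 = 0"
    using phi_scaleR[OF xi_tangent, of q 0] by simp
  moreover have "g2 q (U q) 0 = 0" "g2 q (V q) 0 = 0" "g2 q (N2 (p, q)) 0 = 0" "g2 q (nabla2 U V q) 0 = 0" "\<eta> q 0 = 0"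
    using form_zero_right[OF form tangent_zero tangent_zero] one_form_zero[OF eta tangent_zero]
      vfieldsD(1)[OF U] vfieldsD(1)[OF V] N2_tangent nabla2_tangent by simp_all
  ultimately show ?thesis
    using koszul_vertical[OF z tangent_zero[of A2 q]] unfolding eta_bar_N by (simp add: algebra_simps)
qed

text \<open>Both equations share one case distinction: linearity of \<omega> applies to tangent
  vectors, and the gradient is shown to be one only where its coefficient is nonzero. Elsewhere both
  sides are 0 whatever the description denotes.\<close>

lemma N1_eq: "N1 (p, q) = - (f p * g2 q (\<phi> q (U q)) (\<phi> q (V q))) *\<^sub>R gradient A1 g1 f p"
    (is "_ = ?c *\<^sub>R _")
  and omega_N1: "\<omega> p (N1 (p, q)) = - (f p * g2 q (\<phi> q (U q)) (\<phi> q (V q))) * \<omega> p (gradient A1 g1 f p)"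
proof -
  \<comment> \<open>Where its coefficient is nonzero, the gradient exists because \<open>N1\<close> is a multiple of it.\<close>
  have "N1 (p, q) = ?c *\<^sub>R gradient A1 g1 f p \<and> \<omega> p (N1 (p, q)) = ?c * \<omega> p (gradient A1 g1 f p)"
  proof (cases "?c = 0")
    case True
    then have "g1 p (N1 (p, q)) (N1 (p, q)) = 0"
      using N1_metric[OF N1_tangent] by simp
    then have "N1 (p, q) = 0"
      by (rule metric_eq_0[OF metric1 N1_tangent])
    then show ?thesis
      unfolding True using one_form_zero[OF omega tangent_zero, of p] by simp
  next
    case False
    let ?v = "inverse ?c *\<^sub>R N1 (p, q)"
    have v: "?v \<in> tangent_space A1 p"
      by (rule tangent_scaleR[OF N1_tangent])
    have "gradient A1 g1 f p = ?v"
    proof (rule gradient_eqI[OF metric1 v])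
      fix w assume w: "w \<in> tangent_space A1 p"
      have "g1 p ?v w = inverse ?c * (?c * w f)"
        unfolding form_scaleR_left[OF form1 N1_tangent N1_tangent w] N1_metric[OF w] ..
      then show "g1 p ?v w = w f" by (simp only: mult.assoc[symmetric] left_inverse[OF False] mult_1_left)
    qed
    then have "?c *\<^sub>R gradient A1 g1 f p = (?c * inverse ?c) *\<^sub>R N1 (p, q)"
      by simp
    then have eq: "N1 (p, q) = ?c *\<^sub>R gradient A1 g1 f p"
      unfolding right_inverse[OF False] scaleR_one by (rule sym)
    show ?thesis
      using eq one_form_scaleR[OF omega v, of ?c] \<open>gradient A1 g1 f p = ?v\<close> by metis
  qed
  then show "N1 (p, q) = ?c *\<^sub>R gradient A1 g1 f p" "\<omega> p (N1 (p, q)) = ?c * \<omega> p (gradient A1 g1 f p)"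
    by blast+
qed

text \<open>The test vector is (0, w). Skew-symmetry of \<phi> moves it off w, which turns 1 - f^2
  into f^2 - 1, and f > 0 allows division by f^2.\<close>

lemma N2_eq:
  "N2 (p, q) = nabla2 U V q
    + (((f p)\<^sup>2 - 1) / (f p)\<^sup>2) *\<^sub>R (\<eta> q (V q) *\<^sub>R \<phi> q (U q) + \<eta> q (U q) *\<^sub>R \<phi> q (V q))
    + (\<alpha> * f p * g2 q (\<phi> q (U q)) (\<phi> q (V q)) * \<omega> p (gradient A1 g1 f p)) *\<^sub>R \<xi> q"
    (is "_ = ?n + ?r *\<^sub>R (?a *\<^sub>R ?u + ?b *\<^sub>R ?v) + ?d *\<^sub>R _")
proof (rule metric_eqI[OF metric N2_tangent])
  have uT: "?u \<in> tangent_space A2 q" and vT: "?v \<in> tangent_space A2 q"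
    by (intro phi_tangent vfieldsD(1)[OF U] vfieldsD(1)[OF V])+
  note T = uT vT nabla2_tangent[of q] xi_tangent[of q]
  show "?n + ?r *\<^sub>R (?a *\<^sub>R ?u + ?b *\<^sub>R ?v) + ?d *\<^sub>R \<xi> q \<in> tangent_space A2 q"
    by (intro tangent_plus tangent_scaleR T)
  fix w assume w: "w \<in> tangent_space A2 q"
  have R: "g2 q (?n + ?r *\<^sub>R (?a *\<^sub>R ?u + ?b *\<^sub>R ?v) + ?d *\<^sub>R \<xi> q) w
      = g2 q ?n w + ?r * (?a * g2 q ?u w + ?b * g2 q ?v w) + ?d * \<eta> q w"
  proof -
    have "g2 q (\<xi> q) w = \<eta> q w"
      using form_sym[OF form xi_tangent xi_tangent w] metric_xi[OF w] by simp
    then show ?thesis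
      by (simp only: form_add_left[OF form _ _ w] form_scaleR_left[OF form _ _ w, OF _ T(1)] T tangent_plus tangent_scaleR)
  qed
  have s: "g2 q (U q) (\<phi> q w) = - g2 q ?u w" "g2 q (V q) (\<phi> q w) = - g2 q ?v w"
    by (intro phi_skew vfieldsD(1)[OF U] vfieldsD(1)[OF V] w)+
  have zero: "g1 p (N1 (p, q)) 0 = 0" "\<omega> p 0 = 0"
    using form_zero_right[OF form1 tangent_zero tangent_zero N1_tangent] one_form_zero[OF omega tangent_zero] by simp_all
  \<comment> \<open>Solving \<open>eta_bar_N\<close> for \<eta>(\<open>N2\<close>) moves \<alpha>
    \<omega>(\<open>N1\<close>) to the other side with a change of sign: this is the coefficient of
    \<xi>.\<close>
  have e: "\<eta> q (N2 (p, q)) = \<eta> q ?n + ?d"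
    using eta_bar_N[of p q] unfolding omega_N1 by (simp add: algebra_simps)
  have "(f p)\<^sup>2 * g2 q (N2 (p, q)) w = (f p)\<^sup>2 * (g2 q ?n w + ?d * \<eta> q w) + ((f p)\<^sup>2 - 1) * (?a * g2 q ?u w + ?b * g2 q ?v w)"
    using koszul_vertical[OF tangent_zero[of A1 p] w] unfolding eta_bar_N unfolding s zero e
    by (simp add: algebra_simps)
  moreover have "(f p)\<^sup>2 \<noteq> 0" using f_pos[of p] by simp
  ultimately show "g2 q (N2 (p, q)) w = g2 q (?n + ?r *\<^sub>R (?a *\<^sub>R ?u + ?b *\<^sub>R ?v) + ?d *\<^sub>R \<xi> q) w"
    unfolding R by (simp add: field_simps)
qed

lemma nabla_lift:
  "N = (\<lambda>(p, q). prod_vec A1 A2 (p, q)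
       (- (f p * g2 q (\<phi> q (U q)) (\<phi> q (V q))) *\<^sub>R gradient A1 g1 f p)
       (nabla2 U V q
        + (((f p)\<^sup>2 - 1) / (f p)\<^sup>2) *\<^sub>R (\<eta> q (V q) *\<^sub>R \<phi> q (U q) + \<eta> q (U q) *\<^sub>R \<phi> q (V q))
        + (\<alpha> * f p * g2 q (\<phi> q (U q)) (\<phi> q (V q)) * \<omega> p (gradient A1 g1 f p)) *\<^sub>R \<xi> q))"
proof -
  have "N (p, q) = prod_vec A1 A2 (p, q) (N1 (p, q)) (N2 (p, q))" for p q
    using pushforward_prod_vec[OF manifold1 manifold, of "N1 (p, q)" "(p, q)" "N2 (p, q)"] N1_tangent N2_tangent
    by (intro prod_tangent_eqI[OF manifold1 manifold N_tangent] prod_vec_tangent[OF manifold1 manifold]) simp_all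
  then show ?thesis
    by (auto simp only: N1_eq N2_eq fun_eq_iff split: prod.splits)
qed

end

end

theorem theorem4p4:
  fixes A1 :: "('a::{t2_space, second_countable_topology}, 'd::euclidean_space) atlas"
    and A2 :: "('b::{t2_space, second_countable_topology}, 'e::euclidean_space) atlas"
    and J :: "'a \<Rightarrow> 'a tangent \<Rightarrow> 'a tangent"
    and g1 :: "'a \<Rightarrow> 'a tangent \<Rightarrow> 'a tangent \<Rightarrow> real"
    and \<omega> :: "'a \<Rightarrow> 'a tangent \<Rightarrow> real"
    and \<phi> :: "'b \<Rightarrow> 'b tangent \<Rightarrow> 'b tangent"
    and \<xi> :: "'b vfield"
    and \<eta> :: "'b \<Rightarrow> 'b tangent \<Rightarrow> real"
    and g2 :: "'b \<Rightarrow> 'b tangent \<Rightarrow> 'b tangent \<Rightarrow> real"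
    and \<alpha> :: real
    and f :: "'a \<Rightarrow> real"
    and nabla2 :: "'b vfield \<Rightarrow> 'b vfield \<Rightarrow> 'b vfield"
    and nabla :: "('a \<times> 'b) vfield \<Rightarrow> ('a \<times> 'b) vfield \<Rightarrow> ('a \<times> 'b) vfield"
  assumes "almost_hermitian A1 J g1"
    and "one_form A1 \<omega>"
    and "\<forall>X\<in>vfields A1. \<forall>Y\<in>vfields A1. ext_deriv \<omega> X Y = fundamental_form J g1 X Y"
    and "K_contact A2 \<phi> \<xi> \<eta> g2"
    and "smooth_fun A1 f"
    and "\<forall>p. f p > 0"
    and "levi_civita A2 g2 nabla2"
    and "levi_civita (prod_atlas A1 A2) (twisted_warped_metric A1 A2 \<alpha> f \<omega> \<eta> g1 g2) nabla"
    and "U \<in> vfields A2"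
    and "V \<in> vfields A2"
  shows "nabla (vertical A1 A2 U) (vertical A1 A2 V) =
    (\<lambda>(p, q). prod_vec A1 A2 (p, q)
       (- (f p * g2 q (\<phi> q (U q)) (\<phi> q (V q))) *\<^sub>R gradient A1 g1 f p)
       (nabla2 U V q
        + (((f p)\<^sup>2 - 1) / (f p)\<^sup>2) *\<^sub>R (\<eta> q (V q) *\<^sub>R \<phi> q (U q) + \<eta> q (U q) *\<^sub>R \<phi> q (V q))
        + (\<alpha> * f p * g2 q (\<phi> q (U q)) (\<phi> q (V q)) * \<omega> p (gradient A1 g1 f p)) *\<^sub>R \<xi> q))"
proof -
  have "twisted_product A2 \<phi> \<xi> \<eta> g2 A1 g1 \<omega> \<alpha> f nabla2 nabla"
    using assms by unfold_locales (simp_all add: almost_hermitian_def K_contact_def)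
  then show ?thesis
    unfolding vertical_eq by (rule twisted_product.nabla_lift) fact+
qed

end
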